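(* Let $\alpha\ge1$. If there is a polynomial-time algorithm that computes an $\alpha$-approximation for Job-Machine Delay Scheduling, then there is a polynomial-time algorithm that computes a $6\alpha$-approximation for Unique Machines Precedence-constrained Scheduling (UMPS).
   Context: In both problems jobs have unit size, time is divided into steps $1,2,\dots$, each machine executes at most one job per step, each job is executed exactly once (no duplication), and the objective is to minimize the makespan (the last step at which a job is executed). An $\alpha$-approximation algorithm outputs a valid schedule whose makespan is at most $\alpha$ times the minimum makespan of a valid schedule. Job-Machine Delay Scheduling: the input is a finite set of jobs with a partial order $\prec$ (precedence), a finite set of machines, and a nonnegative delay $\rho_{v,i}$ for every job-machine pair $(v,i)$. A schedule is valid if whenever $v$ is executed on machine $i$ at time $t$ and $u\prec v$, either $u$ is executed on $i$ before time $t$, or $u$ is executed on some machine $j$ before time $t-\rho_{v,i}$. UMPS: the input is a finite set $V$ of precedence-ordered jobs and a finite set $M$ of identical machines, together with a partition of $V$ into disjoint sets $V_i$, $i\in M$. A schedule is valid if every job of $V_i$ is executed on machine $i$ (for each $i\in M$), and whenever $u\prec v$, $u$ is executed before $v$. There are no communication delays. *)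

theory Defs
  imports
    Complex_Main
    "HOL-Computational_Algebra.Polynomial"
    "HOL-Library.Disjoint_Sets"
begin

section \<open>Scheduling problems\<close>

text \<open>\<open>(u, v) \<in> prec I\<close> stands for \<open>u \<prec> v\<close>.\<close>

record ('j, 'm) input =
  jobs :: "'j set"
  machines :: "'m set"
  prec :: "('j \<times> 'j) set"

definition wf_input :: "('j, 'm, 'z) input_scheme \<Rightarrow> bool" where
  "wf_input I \<longleftrightarrow> finite (jobs I) \<and> finite (machines I) \<and>
     prec I \<subseteq> jobs I \<times> jobs I \<and> irrefl (prec I) \<and> trans (prec I)"

text \<open>
  A schedule maps a job to the machine and the time step at which it is executed, so that a job
  is executed exactly once. Injectivity means that a machine executes at most one job per step.
\<close>

type_synonym ('j, 'm) schedule = "'j \<Rightarrow> 'm \<times> nat"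

definition is_schedule :: "('j, 'm, 'z) input_scheme \<Rightarrow> ('j, 'm) schedule \<Rightarrow> bool" where
  "is_schedule I \<sigma> \<longleftrightarrow>
     (\<forall>v\<in>jobs I. fst (\<sigma> v) \<in> machines I \<and> 1 \<le> snd (\<sigma> v)) \<and> inj_on \<sigma> (jobs I)"

definition makespan :: "('j, 'm, 'z) input_scheme \<Rightarrow> ('j, 'm) schedule \<Rightarrow> nat" where
  "makespan I \<sigma> = Max (insert 0 ((\<lambda>v. snd (\<sigma> v)) ` jobs I))"

definition min_makespan ::
  "(('j, 'm, 'z) input_scheme \<Rightarrow> ('j, 'm) schedule \<Rightarrow> bool) \<Rightarrow> ('j, 'm, 'z) input_scheme \<Rightarrow> nat"
  where "min_makespan valid I = (LEAST k. \<exists>\<sigma>. valid I \<sigma> \<and> makespan I \<sigma> = k)"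

subsection \<open>Job-machine delay scheduling\<close>

text \<open>Delays are rational, so that instances have finite encodings.\<close>

record ('j, 'm) jmd = "('j, 'm) input" +
  delay :: "'j \<Rightarrow> 'm \<Rightarrow> rat"

definition wf_jmd :: "('j, 'm) jmd \<Rightarrow> bool" where
  "wf_jmd I \<longleftrightarrow> wf_input I \<and> (\<forall>v\<in>jobs I. \<forall>i\<in>machines I. 0 \<le> delay I v i)"

definition valid_jmd :: "('j, 'm) jmd \<Rightarrow> ('j, 'm) schedule \<Rightarrow> bool" where
  "valid_jmd I \<sigma> \<longleftrightarrow> is_schedule I \<sigma> \<and>
     (\<forall>(u, v)\<in>prec I.
        (fst (\<sigma> u) = fst (\<sigma> v) \<and> snd (\<sigma> u) < snd (\<sigma> v)) \<or>
        of_nat (snd (\<sigma> u)) < of_nat (snd (\<sigma> v)) - delay I v (fst (\<sigma> v)))"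

subsection \<open>Unique machines precedence-constrained scheduling\<close>

record ('j, 'm) umps = "('j, 'm) input" +
  part :: "'m \<Rightarrow> 'j set"

definition wf_umps :: "('j, 'm) umps \<Rightarrow> bool" where
  "wf_umps I \<longleftrightarrow> wf_input I \<and>
     (\<Union>i\<in>machines I. part I i) = jobs I \<and> disjoint_family_on (part I) (machines I)"

definition valid_umps :: "('j, 'm) umps \<Rightarrow> ('j, 'm) schedule \<Rightarrow> bool" where
  "valid_umps I \<sigma> \<longleftrightarrow> is_schedule I \<sigma> \<and>
     (\<forall>i\<in>machines I. \<forall>v\<in>part I i. fst (\<sigma> v) = i) \<and>
     (\<forall>(u, v)\<in>prec I. snd (\<sigma> u) < snd (\<sigma> v))"

section \<open>Polynomial-time algorithms\<close>

text \<open>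
  The model of computation is Jones's WHILE language (N. D. Jones, Computability and Complexity
  from a Programming Perspective), whose data are binary trees with \<open>hd\<close>, \<open>tl\<close> and \<open>cons\<close>.
  Conditions are true iff they do not evaluate to \<open>Leaf\<close>.
  Unlike in Jones's unit-cost measure, evaluating an expression is charged for the size of every
  (intermediate) value. The running time hence bounds the size of all trees that are built, and a
  function is computable in polynomial time in this model iff it is so on a Turing machine that
  reads and writes the trees as strings.
\<close>

datatype tree = Leaf | Node tree tree

fun left :: "tree \<Rightarrow> tree" where
  "left Leaf = Leaf"
| "left (Node l r) = l"

fun right :: "tree \<Rightarrow> tree" where
  "right Leaf = Leaf"
| "right (Node l r) = r"

datatype expr = Var nat | ENil | ECons expr expr | EHd expr | ETl expr

datatype com =
    Skip
  | Assign nat expr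
  | Seq com com
  | Cond expr com com
  | While expr com

type_synonym state = "nat \<Rightarrow> tree"

fun val :: "expr \<Rightarrow> state \<Rightarrow> tree" where
  "val (Var x) s = s x"
| "val ENil s = Leaf"
| "val (ECons a b) s = Node (val a s) (val b s)"
| "val (EHd a) s = left (val a s)"
| "val (ETl a) s = right (val a s)"

fun cost :: "expr \<Rightarrow> state \<Rightarrow> nat" where
  "cost (Var x) s = 1 + size (s x)"
| "cost ENil s = 1"
| "cost (ECons a b) s = cost a s + cost b s + 1 + size (val (ECons a b) s)"
| "cost (EHd a) s = cost a s + 1 + size (val (EHd a) s)"
| "cost (ETl a) s = cost a s + 1 + size (val (ETl a) s)"

text \<open>\<open>exec c s t s'\<close>: from state \<open>s\<close>, \<open>c\<close> halts in state \<open>s'\<close> after time \<open>t\<close>.\<close>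

inductive exec :: "com \<Rightarrow> state \<Rightarrow> nat \<Rightarrow> state \<Rightarrow> bool" where
  Skip: "exec Skip s 1 s"
| Assign: "exec (Assign x a) s (1 + cost a s) (s(x := val a s))"
| Seq: "exec c1 s1 t1 s2 \<Longrightarrow> exec c2 s2 t2 s3 \<Longrightarrow> exec (Seq c1 c2) s1 (1 + t1 + t2) s3"
| CondTrue: "val b s \<noteq> Leaf \<Longrightarrow> exec c1 s t s' \<Longrightarrow> exec (Cond b c1 c2) s (1 + cost b s + t) s'"
| CondFalse: "val b s = Leaf \<Longrightarrow> exec c2 s t s' \<Longrightarrow> exec (Cond b c1 c2) s (1 + cost b s + t) s'"
| WhileFalse: "val b s = Leaf \<Longrightarrow> exec (While b c) s (1 + cost b s) s"
| WhileTrue: "val b s1 \<noteq> Leaf \<Longrightarrow> exec c s1 t1 s2 \<Longrightarrow> exec (While b c) s2 t2 s3 \<Longrightarrow>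
    exec (While b c) s1 (1 + cost b s1 + t1 + t2) s3"

inductive_cases exec_SkipE: "exec Skip s t s'"
inductive_cases exec_AssignE: "exec (Assign x a) s t s'"
inductive_cases exec_SeqE: "exec (Seq c1 c2) s t s'"
inductive_cases exec_CondE: "exec (Cond b c1 c2) s t s'"
inductive_cases exec_WhileE: "exec (While b c) s t s'"

lemma exec_deterministic:
  "exec c s t s' \<Longrightarrow> exec c s u r \<Longrightarrow> u = t \<and> r = s'"
proof (induction arbitrary: u r rule: exec.induct)
  case (Skip s)
  then show ?case by (elim exec_SkipE) simp
next
  case (Assign x a s)
  then show ?case by (elim exec_AssignE) simp
next
  case (Seq c1 s1 t1 s2 c2 t2 s3)
  from Seq.prems show ?case
    by (rule exec_SeqE) (auto dest!: Seq.IH(1) Seq.IH(2))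
next
  case (CondTrue b s c1 t s' c2)
  from CondTrue.prems show ?case
    by (rule exec_CondE) (auto simp: CondTrue.hyps dest!: CondTrue.IH)
next
  case (CondFalse b s c2 t s' c1)
  from CondFalse.prems show ?case
    by (rule exec_CondE) (auto simp: CondFalse.hyps dest!: CondFalse.IH)
next
  case (WhileFalse b s c)
  from WhileFalse.prems show ?case
    by (rule exec_WhileE) (auto simp: WhileFalse.hyps)
next
  case (WhileTrue b s1 c t1 s2 t2 s3)
  from WhileTrue.prems show ?case
    by (rule exec_WhileE) (auto simp: WhileTrue.hyps dest!: WhileTrue.IH(1) WhileTrue.IH(2))
qed

text \<open>Input and output are passed in variable 0; all other variables are initially \<open>Leaf\<close>.\<close>

definition runs :: "com \<Rightarrow> tree \<Rightarrow> nat \<Rightarrow> tree \<Rightarrow> bool" where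
  "runs p x t y \<longleftrightarrow> (\<exists>s'. exec p ((\<lambda>_. Leaf)(0 := x)) t s' \<and> s' 0 = y)"

subsection \<open>Encoding of instances and schedules\<close>

definition enc_bool :: "bool \<Rightarrow> tree" where
  "enc_bool b = (if b then Node Leaf Leaf else Leaf)"

text \<open>Binary notation, least significant bit first.\<close>

fun enc_nat :: "nat \<Rightarrow> tree" where
  "enc_nat n = (if n = 0 then Leaf else Node (enc_bool (odd n)) (enc_nat (n div 2)))"

declare enc_nat.simps [simp del]

definition enc_list :: "('a \<Rightarrow> tree) \<Rightarrow> 'a list \<Rightarrow> tree" where
  "enc_list f xs = foldr (\<lambda>x. Node (f x)) xs Leaf"

text \<open>Finite sets of numbers are encoded as increasing lists, and families indexed by them as
  lists of values in the same order.\<close>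

definition enc_fam :: "('a \<Rightarrow> tree) \<Rightarrow> nat set \<Rightarrow> (nat \<Rightarrow> 'a) \<Rightarrow> tree" where
  "enc_fam f A g = enc_list (\<lambda>a. f (g a)) (sorted_list_of_set A)"

definition enc_set :: "nat set \<Rightarrow> tree" where
  "enc_set A = enc_fam enc_nat A (\<lambda>a. a)"

text \<open>Only nonnegative rationals occur.\<close>

definition enc_rat :: "rat \<Rightarrow> tree" where
  "enc_rat r = Node (enc_nat (nat (fst (quotient_of r)))) (enc_nat (nat (snd (quotient_of r))))"

definition enc_input :: "(nat, nat, 'z) input_scheme \<Rightarrow> tree" where
  "enc_input I = Node (enc_set (jobs I)) (Node (enc_set (machines I))
     (enc_fam (enc_fam enc_bool (jobs I)) (jobs I) (\<lambda>u v. (u, v) \<in> prec I)))"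

definition enc_jmd :: "(nat, nat) jmd \<Rightarrow> tree" where
  "enc_jmd I = Node (enc_input I) (enc_fam (enc_fam enc_rat (machines I)) (jobs I) (delay I))"

definition enc_umps :: "(nat, nat) umps \<Rightarrow> tree" where
  "enc_umps I = Node (enc_input I)
     (enc_fam (enc_fam enc_bool (machines I)) (jobs I) (\<lambda>v i. v \<in> part I i))"

definition enc_schedule :: "(nat, nat, 'z) input_scheme \<Rightarrow> (nat, nat) schedule \<Rightarrow> tree" where
  "enc_schedule I \<sigma> = enc_fam (\<lambda>(i, t). Node (enc_nat i) (enc_nat t)) (jobs I) \<sigma>"

subsection \<open>Approximation algorithms\<close>

text \<open>
  The algorithm halts in polynomial time on every instance. Its output is constrained only if a
  valid schedule exists, since otherwise there is no minimum makespan; the only such instances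
  are those of the delay problem that have jobs but no machine.
\<close>

definition poly_time_approx ::
  "((nat, nat, 'z) input_scheme \<Rightarrow> bool) \<Rightarrow> ((nat, nat, 'z) input_scheme \<Rightarrow> tree) \<Rightarrow>
   ((nat, nat, 'z) input_scheme \<Rightarrow> (nat, nat) schedule \<Rightarrow> bool) \<Rightarrow> real \<Rightarrow> com \<Rightarrow> bool" where
  "poly_time_approx wf_inst enc valid \<alpha> p \<longleftrightarrow>
     (\<exists>q :: nat poly. \<forall>I. wf_inst I \<longrightarrow>
        (\<exists>t y. runs p (enc I) t y \<and> t \<le> poly q (size (enc I)) \<and>
           ((\<exists>\<sigma>. valid I \<sigma>) \<longrightarrow>
              (\<exists>\<sigma>. y = enc_schedule I \<sigma> \<and> valid I \<sigma> \<and>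
                 real (makespan I \<sigma>) \<le> \<alpha> * real (min_makespan valid I)))))"

definition poly_time_approx_jmd :: "real \<Rightarrow> com \<Rightarrow> bool" where
  "poly_time_approx_jmd = poly_time_approx wf_jmd enc_jmd valid_jmd"

definition poly_time_approx_umps :: "real \<Rightarrow> com \<Rightarrow> bool" where
  "poly_time_approx_umps = poly_time_approx wf_umps enc_umps valid_umps"

end

theory Submission imports Defs
begin

text \<open>
  An instance of UMPS becomes one of the delay problem by giving a job delay 0 on its own machine and
  a delay beyond all relevant makespans on the others, and by adding a job 0 that precedes all
  others. The optimum grows by at most one. In a short enough schedule a job on a foreign machine
  must be on the same machine as all its predecessors, hence on the machine of job 0. So the
  foreign jobs have distinct times, and all jobs can be moved to their own machines when each time
  step is split into two, one for the foreign jobs and one for the others. The makespan is at most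
  \<open>2\<alpha> (opt + 1) + 1 \<le> 6\<alpha> opt\<close>. The transformations of trees are polynomial-time computable because
  they are built from folds over lists whose accumulator grows by a polynomial amount per step.
\<close>

section \<open>Polynomial-time functions on trees\<close>

definition run_in :: "com \<Rightarrow> state \<Rightarrow> nat \<Rightarrow> (state \<Rightarrow> bool) \<Rightarrow> bool" where
  "run_in c s T Q \<longleftrightarrow> (\<exists>t s'. exec c s t s' \<and> t \<le> T \<and> Q s')"

lemma run_in_mono: "run_in c s T P \<Longrightarrow> T \<le> T' \<Longrightarrow> (\<And>s'. P s' \<Longrightarrow> Q s') \<Longrightarrow> run_in c s T' Q"
  unfolding run_in_def by (meson order_trans)

lemma run_in_Assign: "1 + cost a s \<le> T \<Longrightarrow> Q (s(x := val a s)) \<Longrightarrow> run_in (Assign x a) s T Q"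
  unfolding run_in_def using exec.Assign by blast

lemma run_in_Seq:
  assumes "run_in c1 s T1 P" "\<And>s'. P s' \<Longrightarrow> run_in c2 s' T2 Q" "1 + T1 + T2 \<le> T"
  shows "run_in (Seq c1 c2) s T Q"
proof -
  from assms(1) obtain t1 s1 where 1: "exec c1 s t1 s1" "t1 \<le> T1" "P s1"
    unfolding run_in_def by blast
  from assms(2)[OF 1(3)] obtain t2 s2 where 2: "exec c2 s1 t2 s2" "t2 \<le> T2" "Q s2"
    unfolding run_in_def by blast
  show ?thesis
    unfolding run_in_def using exec.Seq[OF 1(1) 2(1)] 1 2 assms(3)
    by (intro exI[of _ "1 + t1 + t2"] exI[of _ s2]) simp
qed

definition triple :: "(state \<Rightarrow> bool) \<Rightarrow> com \<Rightarrow> nat \<Rightarrow> (state \<Rightarrow> bool) \<Rightarrow> bool" where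
  "triple P c T Q \<longleftrightarrow> (\<forall>s. P s \<longrightarrow> run_in c s T Q)"

lemma tripleI: "(\<And>s. P s \<Longrightarrow> run_in c s T Q) \<Longrightarrow> triple P c T Q"
  unfolding triple_def by simp

lemma triple_Seq: "triple P c1 T1 R \<Longrightarrow> triple R c2 T2 Q \<Longrightarrow> triple P (Seq c1 c2) (1 + T1 + T2) Q"
  unfolding triple_def by (blast intro: run_in_Seq[OF _ _ order_refl])

lemma run_in_triple: "triple P c T Q \<Longrightarrow> P s \<Longrightarrow> T \<le> T' \<Longrightarrow> run_in c s T' Q"
  unfolding triple_def by (blast intro: run_in_mono)

lemma run_in_Cond:
  assumes "run_in (if val b s \<noteq> Leaf then c1 else c2) s T Q" "1 + cost b s + T \<le> T'"
  shows "run_in (Cond b c1 c2) s T' Q"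
proof -
  from assms(1) obtain t s' where 1: "exec (if val b s \<noteq> Leaf then c1 else c2) s t s'" "t \<le> T" "Q s'"
    unfolding run_in_def by blast
  have "exec (Cond b c1 c2) s (1 + cost b s + t) s'"
    using 1(1) exec.CondTrue[of b s c1 t s' c2] exec.CondFalse[of b s c2 t s' c1] by (cases "val b s = Leaf") simp_all
  then show ?thesis
    unfolding run_in_def using 1 assms(2)
    by (intro exI[of _ "1 + cost b s + t"] exI[of _ s']) simp
qed

lemma run_in_WhileFalse: "val b s = Leaf \<Longrightarrow> Q s \<Longrightarrow> 1 + cost b s \<le> T \<Longrightarrow> run_in (While b c) s T Q"
  unfolding run_in_def using exec.WhileFalse by blast

lemma run_in_WhileTrue:
  assumes "val b s \<noteq> Leaf" "run_in c s T1 P" "\<And>s'. P s' \<Longrightarrow> run_in (While b c) s' T2 Q"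
    "1 + cost b s + T1 + T2 \<le> T"
  shows "run_in (While b c) s T Q"
proof -
  from assms(2) obtain t1 s1 where 1: "exec c s t1 s1" "t1 \<le> T1" "P s1"
    unfolding run_in_def by blast
  from assms(3)[OF 1(3)] obtain t2 s2 where 2: "exec (While b c) s1 t2 s2" "t2 \<le> T2" "Q s2"
    unfolding run_in_def by blast
  show ?thesis
    unfolding run_in_def using exec.WhileTrue[OF assms(1) 1(1) 2(1)] 1 2 assms(4)
    by (intro exI[of _ "1 + cost b s + t1 + t2"] exI[of _ s2]) simp
qed

lemma size_val_le_cost: "size (val a s) \<le> cost a s"
  by (cases a) auto

text \<open>Every assignment pays for the size of the value it stores, so growth of a variable is
  paid for by running time. Bounds on output sizes hence follow from time bounds.\<close>

lemma exec_size: "exec c s t s' \<Longrightarrow> size (s' x) \<le> size (s x) + t"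
proof (induction rule: exec.induct)
  case (Assign y a s)
  then show ?case using size_val_le_cost[of a s] by simp
qed auto

lemma poly_nat_mono: "m \<le> n \<Longrightarrow> poly q m \<le> poly q n" for q :: "nat poly"
  by (induction q) (auto intro!: mult_mono add_mono)

text \<open>The program \<open>c d\<close> may use all variables from \<open>d\<close> upwards as scratch space, whatever their
  contents, so that programs for different functions can be combined without renaming.\<close>

definition computes :: "(nat \<Rightarrow> com) \<Rightarrow> nat poly \<Rightarrow> (tree \<Rightarrow> tree) \<Rightarrow> bool" where
  "computes c q f \<longleftrightarrow> (\<forall>d s n. size (s d) \<le> n \<longrightarrow> run_in (c d) s (poly q n)
     (\<lambda>s'. s' d = f (s d) \<and> (\<forall>i<d. s' i = s i) \<and> size (s' d) \<le> poly q n))"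

lemma computesD:
  "computes c q f \<Longrightarrow> size (s d) \<le> n \<Longrightarrow> run_in (c d) s (poly q n)
     (\<lambda>s'. s' d = f (s d) \<and> (\<forall>i<d. s' i = s i) \<and> size (s' d) \<le> poly q n)"
  unfolding computes_def by simp

definition ptime :: "(tree \<Rightarrow> tree) \<Rightarrow> bool" where
  "ptime f \<longleftrightarrow> (\<exists>q c. computes c q f)"

lemma ptimeE:
  assumes "ptime f"
  obtains q c where "computes c q f"
  using assms unfolding ptime_def by (elim exE)

text \<open>The size bound in \<open>computes\<close> comes for free: by \<open>exec_size\<close>
  the output is at most the input plus the time, which is why the identity polynomial
  \<open>[:0, 1:]\<close> is added.\<close>

lemma ptimeI:
  assumes "\<And>d s. run_in (c d) s (poly q (size (s d))) (\<lambda>s'. s' d = f (s d) \<and> (\<forall>i<d. s' i = s i))"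
  shows "ptime f"
proof -
  have "run_in (c d) s (poly (q + [:0, 1:]) n)
      (\<lambda>s'. s' d = f (s d) \<and> (\<forall>i<d. s' i = s i) \<and> size (s' d) \<le> poly (q + [:0, 1:]) n)"
    if n: "size (s d) \<le> n" for d s n
  proof -
    from assms[of d s] obtain t s' where *:
       "exec (c d) s t s'" "t \<le> poly q (size (s d))" "s' d = f (s d)" "\<forall>i<d. s' i = s i"
      unfolding run_in_def by (elim exE conjE)
    then have "t \<le> poly (q + [:0, 1:]) n" "size (s' d) \<le> poly (q + [:0, 1:]) n"
      using exec_size[OF *(1), of d] poly_nat_mono[OF n, of q] n by auto
    with * show ?thesis
      unfolding run_in_def by (intro exI[of _ t] exI[of _ s'] conjI)
  qed
  then have "computes c (q + [:0, 1:]) f"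
    unfolding computes_def by simp
  then show ?thesis unfolding ptime_def by (intro exI)
qed

section \<open>Closure properties of polynomial-time functions\<close>

named_theorems ptime

lemma ptime_id [ptime]: "ptime (\<lambda>x. x)"
  by (rule ptimeI[where c = "\<lambda>_. Skip" and q = 1]) (use exec.Skip in \<open>fastforce simp: run_in_def\<close>)

lemma ptime_Leaf [ptime]: "ptime (\<lambda>x. Leaf)"
  by (rule ptimeI[where c = "\<lambda>d. Assign d ENil" and q = "[:2:]"]) (auto intro!: run_in_Assign)

lemma ptime_comp:
  assumes "ptime g" "ptime f"
  shows "ptime (\<lambda>x. g (f x))"
proof -
  from assms(1) obtain p b where pb: "computes b p g"
    by (rule ptimeE)
  from assms(2) obtain q c where qc: "computes c q f"
    by (rule ptimeE)
  show ?thesis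
    \<comment> \<open>The intermediate value has size at most \<open>poly q n\<close>, so the second
      program stays within \<open>pcompose p q\<close>; the summand 1 pays for
      \<open>Seq\<close>.\<close>
    by (rule ptimeI[where c = "\<lambda>d. Seq (c d) (b d)" and q = "q + pcompose p q + 1"],
        rule run_in_Seq[OF computesD[OF qc order_refl]], elim conjE, erule run_in_mono[OF computesD[OF pb]])
      (auto simp: poly_pcompose)
qed

lemma size_left_right: "size (left x) + size (right x) \<le> size x"
  by (cases x) auto

lemma ptime_left [ptime]: "ptime f \<Longrightarrow> ptime (\<lambda>x. left (f x))"
proof (rule ptime_comp[of left])
  have "size (left x) \<le> size x" for x
    using size_left_right[of x] by simp
  then show "ptime left"
    by (intro ptimeI[where c = "\<lambda>d. Assign d (EHd (Var d))" and q = "[:3, 2:]"] run_in_Assign) auto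
qed

lemma ptime_right [ptime]: "ptime f \<Longrightarrow> ptime (\<lambda>x. right (f x))"
proof (rule ptime_comp[of right])
  have "size (right x) \<le> size x" for x
    using size_left_right[of x] by simp
  then show "ptime right"
    by (intro ptimeI[where c = "\<lambda>d. Assign d (ETl (Var d))" and q = "[:3, 2:]"] run_in_Assign) auto
qed

text \<open>Two copies of the input are needed. Running the first program at \<open>Suc d\<close>
  keeps the input in \<open>d\<close>, and running the second at \<open>Suc (Suc d)\<close> keeps
  the first result.\<close>

lemma ptime_Node [ptime]:
  assumes "ptime f" "ptime g"
  shows "ptime (\<lambda>x. Node (f x) (g x))"
proof -
  from assms(1) obtain p b where pb: "computes b p f"
    by (rule ptimeE)
  from assms(2) obtain q c where qc: "computes c q g"
    by (rule ptimeE)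
  show ?thesis
  proof (rule ptimeI)
    fix d and s :: state
    let ?n = "size (s d)"
    let ?P1 = "\<lambda>s'. (\<forall>i\<le>d. s' i = s i) \<and> s' (Suc d) = s d"
    let ?P2 = "\<lambda>s'. (\<forall>i\<le>d. s' i = s i) \<and> s' (Suc d) = f (s d) \<and> size (s' (Suc d)) \<le> poly p ?n"
    let ?P3 = "\<lambda>s'. (\<forall>i<d. s' i = s i) \<and> s' (Suc d) = f (s d) \<and> s' (Suc (Suc d)) = s d \<and> size (s' (Suc d)) \<le> poly p ?n"
    let ?P4 = "\<lambda>s'. (\<forall>i<d. s' i = s i) \<and> s' (Suc d) = f (s d) \<and> s' (Suc (Suc d)) = g (s d) \<and> size (s' (Suc d)) \<le> poly p ?n \<and> size (s' (Suc (Suc d))) \<le> poly q ?n"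
    let ?P5 = "\<lambda>s'. s' d = Node (f (s d)) (g (s d)) \<and> (\<forall>i<d. s' i = s i)"
    have 1: "triple ((=) s) (Assign (Suc d) (Var d)) (2 + ?n) ?P1"
      by (intro tripleI run_in_Assign) auto
    have 2: "triple ?P1 (b (Suc d)) (poly p ?n) ?P2"
      by (intro tripleI run_in_mono[OF computesD[OF pb, where n = ?n]]) auto
    have 3: "triple ?P2 (Assign (Suc (Suc d)) (Var d)) (2 + ?n) ?P3"
      by (intro tripleI run_in_Assign) auto
    have 4: "triple ?P3 (c (Suc (Suc d))) (poly q ?n) ?P4"
      by (intro tripleI run_in_mono[OF computesD[OF qc, where n = ?n]]) auto
    have 5: "triple ?P4 (Assign d (ECons (Var (Suc d)) (Var (Suc (Suc d))))) (5 + 2 * poly p ?n + 2 * poly q ?n) ?P5"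
      by (intro tripleI run_in_Assign) auto
    show "run_in (Seq (Assign (Suc d) (Var d)) (Seq (b (Suc d)) (Seq (Assign (Suc (Suc d)) (Var d))
        (Seq (c (Suc (Suc d))) (Assign d (ECons (Var (Suc d)) (Var (Suc (Suc d)))))))))
        s (poly (smult 3 p + smult 3 q + [:13, 2:]) ?n) ?P5"
      by (rule run_in_triple[OF triple_Seq[OF 1 triple_Seq[OF 2 triple_Seq[OF 3 triple_Seq[OF 4 5]]]]]) simp_all
  qed
qed

lemma ptime_comp2:
  assumes "ptime (\<lambda>z. h (left z) (right z))" "ptime f" "ptime g"
  shows "ptime (\<lambda>x. h (f x) (g x))"
  using ptime_comp[OF assms(1) ptime_Node[OF assms(2,3)]] by simp

lemma ptime_const [ptime]: "ptime (\<lambda>_. t)"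
  by (induction t) (simp_all add: ptime_Leaf ptime_Node)

text \<open>Condition and argument are first packed into a pair, so that one variable carries both.
  The sum of the bounds of the branches covers whichever branch runs.\<close>

lemma ptime_If [ptime]:
  assumes "ptime f" "ptime g" "ptime h"
  shows "ptime (\<lambda>x. if f x \<noteq> Leaf then g x else h x)"
proof -
  from assms(2) obtain p b where pb: "computes b p g"
    by (rule ptimeE)
  from assms(3) obtain q c where qc: "computes c q h"
    by (rule ptimeE)
  have "ptime (\<lambda>z. if left z \<noteq> Leaf then g (right z) else h (right z))"
  proof (rule ptimeI)
    fix d and s :: state
    let ?n = "size (s d)"
    let ?P0 = "\<lambda>s'. (\<forall>i\<le>d. s' i = s i) \<and> s' (Suc d) = left (s d)"
    let ?P1 = "\<lambda>s'. (\<forall>i<d. s' i = s i) \<and> s' d = right (s d) \<and> s' (Suc d) = left (s d)"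
    let ?P2 = "\<lambda>s'. s' d = (if left (s d) \<noteq> Leaf then g (right (s d)) else h (right (s d)))
      \<and> (\<forall>i<d. s' i = s i)"
    have l: "size (left (s d)) \<le> ?n" and r: "size (right (s d)) \<le> ?n"
      using size_left_right[of "s d"] by auto
    have 1: "triple ((=) s) (Assign (Suc d) (EHd (Var d))) (3 + 2 * ?n) ?P0"
      using l by (intro tripleI run_in_Assign) auto
    have 2: "triple ?P0 (Assign d (ETl (Var d))) (3 + 2 * ?n) ?P1"
      using r by (intro tripleI run_in_Assign) auto
    have 3: "triple ?P1 (Cond (Var (Suc d)) (b d) (c d)) (2 + ?n + (poly p ?n + poly q ?n)) ?P2"
    proof (rule tripleI, rule run_in_Cond)
      fix s' assume that: "?P1 s'"
      show "run_in (if val (Var (Suc d)) s' \<noteq> Leaf then b d else c d) s' (poly p ?n + poly q ?n) ?P2"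
      proof (cases "left (s d) = Leaf")
        case True
        have "run_in (c d) s' (poly p ?n + poly q ?n) ?P2"
          by (rule run_in_mono[OF computesD[OF qc, where n = ?n]]) (use that r True in simp_all)
        with True that show ?thesis by simp
      next
        case False
        have "run_in (b d) s' (poly p ?n + poly q ?n) ?P2"
          by (rule run_in_mono[OF computesD[OF pb, where n = ?n]]) (use that r False in simp_all)
        with False that show ?thesis by simp
      qed
      show "1 + cost (Var (Suc d)) s' + (poly p ?n + poly q ?n) \<le> 2 + ?n + (poly p ?n + poly q ?n)"
        using that l by simp
    qed
    show "run_in (Seq (Assign (Suc d) (EHd (Var d))) (Seq (Assign d (ETl (Var d)))
        (Cond (Var (Suc d)) (b d) (c d)))) s (poly (p + q + [:10, 5:]) ?n) ?P2"
      by (rule run_in_triple[OF triple_Seq[OF 1 triple_Seq[OF 2 3]]]) simp_all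
  qed
  from ptime_comp[OF this ptime_Node[OF assms(1) ptime_id]] show ?thesis by (simp cong: if_cong)
qed

section \<open>Folds and list operations on trees, with lists along the right spine\<close>

fun foldt :: "(tree \<Rightarrow> tree \<Rightarrow> tree) \<Rightarrow> tree \<Rightarrow> tree \<Rightarrow> tree" where
  "foldt g Leaf a = a"
| "foldt g (Node e l) a = foldt g l (g e a)"

text \<open>Variable \<open>d\<close> holds the parameter, \<open>d + 1\<close> the remaining list,
  \<open>d + 2\<close> the accumulator; the body works from \<open>d + 3\<close> on. The number of
  remaining iterations is at most \<open>size l\<close> and each adds at most \<open>R\<close>, so
  the accumulator stays below \<open>A\<close>, the argument of the body below \<open>N\<close>, and
  an iteration costs at most \<open>W\<close>.\<close>

lemma run_in_foldt_loop:
  fixes d :: nat and x :: tree and s0 :: state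
  defines "Inv \<equiv> \<lambda>l a s. (\<forall>i<d. s i = s0 i) \<and> s d = x \<and> s (d + 1) = l \<and> s (d + 2) = a"
  assumes c: "computes c q (\<lambda>z. g (left z) (left (right z)) (right (right z)))"
    and growth: "\<And>e a. size e \<le> n \<Longrightarrow> size (g e a x) \<le> size a + R"
    and N: "2 * n + A + 2 \<le> N" and W: "W = 30 + 20 * N + 2 * poly q N" and x: "size x \<le> n"
    and s: "Inv l a s" and l: "size l \<le> n" and a: "size a + size l * R \<le> A"
  shows "run_in (While (Var (d + 1))
      (Seq (Assign (d + 3) (ECons (EHd (Var (d + 1))) (ECons (Var (d + 2)) (Var d))))
        (Seq (c (d + 3)) (Seq (Assign (d + 2) (Var (d + 3))) (Assign (d + 1) (ETl (Var (d + 1))))))))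
      s (2 + size l * W)
      (\<lambda>s'. (\<forall>i<d. s' i = s0 i) \<and> s' (d + 2) = foldt (\<lambda>e a. g e a x) l a \<and> size (s' (d + 2)) \<le> A)"
    (is "run_in (While _ ?body) _ _ (?Q l a)")
  using s l a
proof (induction l arbitrary: a s)
  case Leaf
  then show ?case by (intro run_in_WhileFalse) (auto simp: Inv_def)
next
  case (Node e l)
  have ga: "size (g e a x) \<le> size a + R"
    using Node.prems(2) by (intro growth) simp
  \<comment> \<open>\<open>size (Node e l)\<close> exceeds \<open>size l\<close> by at least one,
    and this unit pays for the growth \<open>R\<close> of the current step.\<close>
  with Node.prems(3) have gA: "size (g e a x) + size l * R \<le> A" by (simp add: algebra_simps)
  let ?z = "Node e (Node a x)"
  let ?K = "\<lambda>s'. (\<forall>i<d. s' i = s0 i) \<and> s' d = x \<and> s' (d + 1) = Node e l"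
  have z: "size ?z \<le> N" and aA: "size a \<le> A" and eN: "size e \<le> n" "size l \<le> n"
    using Node.prems N x by auto
  have 1: "triple (Inv (Node e l) a) (Assign (d + 3) (ECons (EHd (Var (d + 1))) (ECons (Var (d + 2)) (Var d))))
      (20 + 10 * N) (\<lambda>s'. ?K s' \<and> s' (d + 3) = ?z)"
    using Node.prems N x aA eN by (intro tripleI run_in_Assign) ((simp add: Inv_def; fail) | auto simp: Inv_def)+
  have 2: "triple (\<lambda>s'. ?K s' \<and> s' (d + 3) = ?z) (c (d + 3)) (poly q N)
      (\<lambda>s'. ?K s' \<and> s' (d + 3) = g e a x \<and> size (s' (d + 3)) \<le> poly q N)"
    using z by (intro tripleI run_in_mono[OF computesD[OF c, where n = N]]) auto
  have 3: "triple (\<lambda>s'. ?K s' \<and> s' (d + 3) = g e a x \<and> size (s' (d + 3)) \<le> poly q N)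
      (Assign (d + 2) (Var (d + 3))) (2 + poly q N) (\<lambda>s'. ?K s' \<and> s' (d + 2) = g e a x)"
    by (intro tripleI run_in_Assign) ((simp; fail) | auto)+
  have 4: "triple (\<lambda>s'. ?K s' \<and> s' (d + 2) = g e a x) (Assign (d + 1) (ETl (Var (d + 1)))) (3 + 2 * N)
      (Inv l (g e a x))"
    using eN Node.prems(2) N by (intro tripleI run_in_Assign) ((simp add: Inv_def; fail) | auto simp: Inv_def)+
  have body: "run_in ?body s (28 + 12 * N + 2 * poly q N) (Inv l (g e a x))"
    by (rule run_in_triple[OF triple_Seq[OF 1 triple_Seq[OF 2 triple_Seq[OF 3 4]]]])
      (use Node.prems(1) in simp_all)
  show ?case
  proof (rule run_in_WhileTrue[OF _ body])
    show "run_in (While (Var (d + 1)) ?body) s' (2 + size l * W) (?Q (Node e l) a)"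
      if "Inv l (g e a x) s'" for s'
      using Node.IH(2)[OF that eN(2) gA] by simp
    show "1 + cost (Var (d + 1)) s + (28 + 12 * N + 2 * poly q N) + (2 + size l * W) \<le> 2 + size (Node e l) * W"
      using Node.prems N W by (auto simp: Inv_def add_mult_distrib)
  qed (use Node.prems in \<open>simp add: Inv_def\<close>)
qed

text \<open>A polynomial-time step alone would not do, since repeated doubling of the accumulator is
  exponential. Here the increment is bounded in terms of the element and the parameter only, so the
  accumulator stays polynomial.\<close>

lemma ptime_foldt:
  assumes "ptime (\<lambda>z. g (left z) (left (right z)) (right (right z)))" "ptime f" "ptime a0"
    and growth: "\<And>e a x. size (g e a x) \<le> size a + poly r (size e + size x)"
  shows "ptime (\<lambda>x. foldt (\<lambda>e a. g e a x) (f x) (a0 x))"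
proof -
  from assms(1) obtain q c where c: "computes c q (\<lambda>z. g (left z) (left (right z)) (right (right z)))"
    by (rule ptimeE)
  \<comment> \<open>For input size n: \<open>Rp\<close> bounds the growth per step (element and
    parameter are at most n each), \<open>Ap\<close> the accumulator, \<open>Np\<close> the argument
    of the body, \<open>Wp\<close> the time of one iteration.\<close>
  define Rp where "Rp = pcompose r [:0, 2:]"
  define Ap where "Ap = [:0, 1:] + [:0, 1:] * Rp"
  define Np where "Np = [:2, 2:] + Ap"
  define Wp where "Wp = [:30:] + smult 20 Np + smult 2 (pcompose q Np)"
  have "ptime (\<lambda>z. foldt (\<lambda>e a. g e a (right (right z))) (left z) (left (right z)))"
  proof (rule ptimeI)
    fix d and s :: state
    let ?n = "size (s d)"
    let ?x = "right (right (s d))"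
    let ?l = "left (s d)"
    let ?a = "left (right (s d))"
    let ?Q = "\<lambda>s'. s' d = foldt (\<lambda>e a. g e a ?x) ?l ?a \<and> (\<forall>i<d. s' i = s i)"
    let ?Inv = "\<lambda>s'. (\<forall>i<d. s' i = s i) \<and> s' d = ?x \<and> s' (d + 1) = ?l \<and> s' (d + 2) = ?a"
    let ?fin = "\<lambda>s'. (\<forall>i<d. s' i = s i) \<and> s' (d + 2) = foldt (\<lambda>e a. g e a ?x) ?l ?a \<and> size (s' (d + 2)) \<le> poly Ap ?n"
    let ?body = "Seq (Assign (d + 3) (ECons (EHd (Var (d + 1))) (ECons (Var (d + 2)) (Var d))))
        (Seq (c (d + 3)) (Seq (Assign (d + 2) (Var (d + 3))) (Assign (d + 1) (ETl (Var (d + 1))))))"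
    have sz: "size ?l \<le> ?n" "size (right (s d)) \<le> ?n" "size ?a \<le> ?n" "size ?x \<le> ?n"
      using size_left_right[of "s d"] size_left_right[of "right (s d)"] by auto
    have 1: "triple ((=) s) (Assign (d + 1) (EHd (Var d))) (3 + 2 * ?n)
        (\<lambda>s'. (\<forall>i\<le>d. s' i = s i) \<and> s' (d + 1) = ?l)"
      using sz by (intro tripleI run_in_Assign) ((simp; fail) | auto)+
    have 2: "triple (\<lambda>s'. (\<forall>i\<le>d. s' i = s i) \<and> s' (d + 1) = ?l) (Assign (d + 2) (EHd (ETl (Var d)))) (4 + 3 * ?n)
        (\<lambda>s'. (\<forall>i\<le>d. s' i = s i) \<and> s' (d + 1) = ?l \<and> s' (d + 2) = ?a)"
      using sz by (intro tripleI run_in_Assign) ((simp; fail) | auto)+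
    have 3: "triple (\<lambda>s'. (\<forall>i\<le>d. s' i = s i) \<and> s' (d + 1) = ?l \<and> s' (d + 2) = ?a)
        (Assign d (ETl (ETl (Var d)))) (4 + 3 * ?n) ?Inv"
      using sz by (intro tripleI run_in_Assign) ((simp; fail) | auto)+
    have 4: "triple ?Inv (While (Var (d + 1)) ?body) (2 + ?n * poly Wp ?n) ?fin"
    proof (rule tripleI)
      fix s' assume s': "?Inv s'"
      have "run_in (While (Var (d + 1)) ?body) s' (2 + size ?l * poly Wp ?n) ?fin"
      proof (rule run_in_foldt_loop[OF c])
        fix e a :: tree assume "size e \<le> ?n"
        then have "poly r (size e + size ?x) \<le> poly Rp ?n"
          using sz by (auto simp: Rp_def poly_pcompose intro!: poly_nat_mono)
        with growth[of e a ?x] show "size (g e a ?x) \<le> size a + poly Rp ?n" by simp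
      next
        show "size ?a + size ?l * poly Rp ?n \<le> poly Ap ?n"
          using sz by (auto simp: Ap_def intro!: add_mono)
      qed (use sz s' in \<open>auto simp: Np_def Wp_def poly_pcompose mult.commute\<close>)
      then show "run_in (While (Var (d + 1)) ?body) s' (2 + ?n * poly Wp ?n) ?fin"
        using sz by (elim run_in_mono) auto
    qed
    have 5: "triple ?fin (Assign d (Var (d + 2))) (2 + poly Ap ?n) ?Q"
      by (intro tripleI run_in_Assign) ((simp; fail) | auto)+
    show "run_in (Seq (Assign (d + 1) (EHd (Var d))) (Seq (Assign (d + 2) (EHd (ETl (Var d))))
        (Seq (Assign d (ETl (ETl (Var d)))) (Seq (While (Var (d + 1)) ?body) (Assign d (Var (d + 2)))))))
        s (poly ([:30, 10:] + [:0, 1:] * Wp + Ap) ?n) ?Q"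
      by (rule run_in_triple[OF triple_Seq[OF 1 triple_Seq[OF 2 triple_Seq[OF 3 triple_Seq[OF 4 5]]]]]) (simp_all add: algebra_simps)
  qed
  from ptime_comp[OF this ptime_Node[OF assms(2) ptime_Node[OF assms(3) ptime_id]]]
  show ?thesis by simp
qed

definition revt :: "tree \<Rightarrow> tree" where
  "revt l = foldt Node l Leaf"

lemma ptime_revt [ptime]: "ptime f \<Longrightarrow> ptime (\<lambda>x. revt (f x))"
  unfolding revt_def
  by (rule ptime_foldt[where g = "\<lambda>e a x. Node e a" and r = "[:1, 1:]"]) (assumption | intro ptime | simp)+

definition mapt :: "(tree \<Rightarrow> tree) \<Rightarrow> tree \<Rightarrow> tree" where
  "mapt g l = revt (foldt (\<lambda>e. Node (g e)) l Leaf)"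

lemma ptime_mapt [ptime]:
  assumes "ptime f" "ptime (\<lambda>z. g (left z) (right z))"
  shows "ptime (\<lambda>x. mapt (\<lambda>e. g e x) (f x))"
proof -
  obtain q c where c: "computes c q (\<lambda>z. g (left z) (right z))"
    using assms(2) by (rule ptimeE)
  \<comment> \<open>The output bound carried by \<open>computes\<close> limits the size of
    \<open>g e x\<close>, which yields the growth condition for the fold.\<close>
  have "size (g e x) \<le> poly q (Suc (size e + size x))" for e x
  proof -
    from computesD[OF c, of "\<lambda>_. Node e x" 0, OF order_refl] show ?thesis
      by (auto simp: run_in_def)
  qed
  then have "ptime (\<lambda>x. foldt (\<lambda>e a. Node (g e x) a) (f x) Leaf)"
    by (intro ptime_foldt[where g = "\<lambda>e a x. Node (g e x) a" and r = "pcompose q [:1, 1:] + 1"]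
        ptime_Node assms(1) ptime_comp2[OF assms(2)] ptime_left ptime_right ptime_id ptime_Leaf)
      (auto simp: poly_pcompose)
  then show ?thesis
    unfolding mapt_def by (rule ptime_revt)
qed

text \<open>The accumulator pairs the unread part of \<open>m\<close> with the reversed
  result.\<close>

definition zipt :: "tree \<Rightarrow> tree \<Rightarrow> tree" where
  "zipt l m = revt (right (foldt (\<lambda>e a. Node (right (left a)) (Node (Node e (left (left a))) (right a)))
     l (Node m Leaf)))"

lemma ptime_zipt [ptime]:
  assumes "ptime f" "ptime g"
  shows "ptime (\<lambda>x. zipt (f x) (g x))"
proof -
  let ?h = "\<lambda>e a. Node (right (left a)) (Node (Node e (left (left a))) (right a))"
  \<comment> \<open>The head of the unread list only moves from one component to the other, so the
    growth comes from \<open>e\<close> and three new nodes.\<close>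
  have "size (?h e a) \<le> size a + poly [:3, 1:] (size e + size x)" for e a x :: tree
    using size_left_right[of a] size_left_right[of "left a"] by simp
  then have "ptime (\<lambda>x. foldt ?h (f x) (Node (g x) Leaf))"
    by (intro ptime_foldt[where g = "\<lambda>e a x. ?h e a"] assms ptime_Node ptime_left ptime_right
        ptime_id ptime_Leaf)
  then show ?thesis
    unfolding zipt_def by (intro ptime_revt ptime_right)
qed

section \<open>Composition with a given program\<close>

fun vars_below :: "nat \<Rightarrow> expr \<Rightarrow> bool" where
  "vars_below N (Var x) = (x < N)"
| "vars_below N ENil = True"
| "vars_below N (ECons a b) = (vars_below N a \<and> vars_below N b)"
| "vars_below N (EHd a) = vars_below N a"
| "vars_below N (ETl a) = vars_below N a"

fun com_below :: "nat \<Rightarrow> com \<Rightarrow> bool" where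
  "com_below N Skip = True"
| "com_below N (Assign x a) = (x < N \<and> vars_below N a)"
| "com_below N (Seq c1 c2) = (com_below N c1 \<and> com_below N c2)"
| "com_below N (Cond b c1 c2) = (vars_below N b \<and> com_below N c1 \<and> com_below N c2)"
| "com_below N (While b c) = (vars_below N b \<and> com_below N c)"

lemma vars_below_mono: "vars_below M a \<Longrightarrow> M \<le> N \<Longrightarrow> vars_below N a"
  by (induction a) auto

lemma com_below_mono: "com_below M c \<Longrightarrow> M \<le> N \<Longrightarrow> com_below N c"
  by (induction c) (auto intro: vars_below_mono)

lemma vars_below_exists: "\<exists>N. vars_below N a"
proof (induction a)
  case (Var x)
  then show ?case by (intro exI[of _ "Suc x"]) simp
next
  case (ECons a b)
  then obtain M N where "vars_below M a" "vars_below N b" by blast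
  then have "vars_below (max M N) (ECons a b)"
    using vars_below_mono[of M a "max M N"] vars_below_mono[of N b "max M N"] by simp
  then show ?case ..
qed auto

lemma com_below_exists: "\<exists>N. com_below N c"
proof (induction c)
  case (Assign x a)
  obtain N where "vars_below N a" using vars_below_exists by blast
  then have "com_below (max N (Suc x)) (Assign x a)"
    using vars_below_mono[of N a "max N (Suc x)"] by simp
  then show ?case ..
next
  case (Seq c1 c2)
  then obtain M N where "com_below M c1" "com_below N c2" by blast
  then have "com_below (max M N) (Seq c1 c2)"
    using com_below_mono[of M c1 "max M N"] com_below_mono[of N c2 "max M N"] by simp
  then show ?case ..
next
  case (Cond b c1 c2)
  then obtain M N where "com_below M c1" "com_below N c2" by blast
  moreover obtain K where "vars_below K b" using vars_below_exists by blast
  ultimately have "com_below (max K (max M N)) (Cond b c1 c2)"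
    using com_below_mono[of M c1 "max K (max M N)"] com_below_mono[of N c2 "max K (max M N)"]
      vars_below_mono[of K b "max K (max M N)"] by simp
  then show ?case ..
next
  case (While b c)
  then obtain M where "com_below M c" by blast
  moreover obtain K where "vars_below K b" using vars_below_exists by blast
  ultimately have "com_below (max K M) (While b c)"
    using com_below_mono[of M c "max K M"] vars_below_mono[of K b "max K M"] by simp
  then show ?case ..
qed auto

definition merge_states :: "nat \<Rightarrow> state \<Rightarrow> state \<Rightarrow> state" where
  "merge_states N s r = (\<lambda>i. if i < N then s i else r i)"

lemma val_merge_states: "vars_below N a \<Longrightarrow> val a (merge_states N s r) = val a s"
  by (induction a) (auto simp: merge_states_def)

lemma cost_merge_states: "vars_below N a \<Longrightarrow> cost a (merge_states N s r) = cost a s"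
  by (induction a) (auto simp: merge_states_def val_merge_states[unfolded merge_states_def])

text \<open>A frame property: variables from \<open>N\<close> on are neither read nor written, so
  they may hold anything, and time and effect below \<open>N\<close> are unchanged.\<close>

lemma exec_merge_states:
  "exec c s t s' \<Longrightarrow> com_below N c \<Longrightarrow> exec c (merge_states N s r) t (merge_states N s' r)"
proof (induction rule: exec.induct)
  case (Assign x a s)
  then have "(merge_states N s r)(x := val a (merge_states N s r)) = merge_states N (s(x := val a s)) r"
    by (auto simp: merge_states_def val_merge_states[unfolded merge_states_def])
  with exec.Assign[of x a "merge_states N s r"] Assign show ?case
    by (metis com_below.simps(2) cost_merge_states)
next
  case (CondTrue b s c1 t s' c2)
  with exec.CondTrue[of b "merge_states N s r" c1 t "merge_states N s' r" c2] show ?case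
    by (simp add: cost_merge_states val_merge_states)
next
  case (CondFalse b s c2 t s' c1)
  with exec.CondFalse[of b "merge_states N s r" c2 t "merge_states N s' r" c1] show ?case
    by (simp add: cost_merge_states val_merge_states)
next
  case (WhileFalse b s c)
  with exec.WhileFalse[of b "merge_states N s r" c] show ?case
    by (simp add: cost_merge_states val_merge_states)
next
  case (WhileTrue b s1 c t1 s2 t2 s3)
  with exec.WhileTrue[of b "merge_states N s1 r" c t1 "merge_states N s2 r" t2 "merge_states N s3 r"]
  show ?case by (simp add: cost_merge_states val_merge_states)
next
  case (Seq c1 s1 t1 s2 c2 t2 s3)
  with exec.Seq[of c1 "merge_states N s1 r" t1 "merge_states N s2 r" c2 t2 "merge_states N s3 r"]
  show ?case by simp
qed (use exec.Skip in simp_all)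

text \<open>The program \<open>p\<close> expects all variables but 0 to be \<open>Leaf\<close> and
  respects no scratch convention. So \<open>N\<close> is chosen above its variables, the other
  computations take place from \<open>N\<close> on, and \<open>N + 1\<close> preserves the original
  input, which \<open>post\<close> needs besides the output of \<open>p\<close>.\<close>

lemma ptime_around_program:
  assumes pre: "ptime pre" and post: "ptime post"
  obtains p' and Q :: "nat poly \<Rightarrow> nat poly" where
    "\<And>q x t y. runs p (pre x) t y \<Longrightarrow> t \<le> poly q (size (pre x)) \<Longrightarrow>
       \<exists>t'. runs p' x t' (post (Node y x)) \<and> t' \<le> poly (Q q) (size x)"
proof -
  from pre obtain q1 c1 where c1: "computes c1 q1 pre" by (rule ptimeE)
  from post obtain q2 c2 where c2: "computes c2 q2 post" by (rule ptimeE)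
  obtain N0 where "com_below N0 p" using com_below_exists by blast
  then obtain N where N: "com_below N p" "0 < N"
    using com_below_mono[of N0 p "Suc N0"] by auto
  let ?p' = "Seq (Assign N (Var 0)) (Seq (c1 N) (Seq (Assign (N + 1) (Var 0)) (Seq (Assign 0 (Var N))
    (Seq p (Seq (Assign N (ECons (Var 0) (Var (N + 1)))) (Seq (c2 N) (Assign 0 (Var N))))))))"
  \<comment> \<open>\<open>Y q\<close> bounds the output of \<open>p\<close>: by
    \<open>exec_size\<close> it is at most the size of \<open>pre x\<close> plus the running
    time.\<close>
  define Y where "Y q = [:0, 1:] + pcompose q q1 + q1" for q :: "nat poly"
  define Q where "Q q = [:100, 10:] + smult 3 q1 + smult 10 (Y q) + smult 2 (pcompose q2 ([:1, 1:] + Y q))" for q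
  have "\<exists>t'. runs ?p' x t' (post (Node y x)) \<and> t' \<le> poly (Q q) (size x)"
    if runs: "runs p (pre x) t y" and t: "t \<le> poly q (size (pre x))" for q x t y
  proof -
    let ?n = "size x"
    let ?s0 = "(\<lambda>_. Leaf)(0 := x)"
    from runs obtain s' where s': "exec p ((\<lambda>_. Leaf)(0 := pre x)) t s'" "s' 0 = y"
      unfolding runs_def by blast
    let ?P0 = "\<lambda>s. s 0 = x \<and> (\<forall>i. 0 < i \<and> i < N \<longrightarrow> s i = Leaf)"
    let ?P1 = "\<lambda>s. ?P0 s \<and> s N = x"
    let ?P2 = "\<lambda>s. ?P0 s \<and> s N = pre x \<and> size (pre x) \<le> poly q1 ?n"
    let ?P3 = "\<lambda>s. ?P2 s \<and> s (N + 1) = x"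
    let ?P4 = "\<lambda>s. (\<forall>i<N. s i = ((\<lambda>_. Leaf)(0 := pre x)) i) \<and> s (N + 1) = x \<and> size (pre x) \<le> poly q1 ?n"
    let ?P5 = "\<lambda>s. s 0 = y \<and> s (N + 1) = x \<and> size y \<le> poly (Y q) ?n"
    let ?P6 = "\<lambda>s. s N = Node y x \<and> size y \<le> poly (Y q) ?n"
    let ?P7 = "\<lambda>s. s N = post (Node y x) \<and> size (s N) \<le> poly q2 (1 + ?n + poly (Y q) ?n)"
    let ?P8 = "\<lambda>s. s 0 = post (Node y x)"
    have 1: "triple ((=) ?s0) (Assign N (Var 0)) (2 + ?n) ?P1"
      using N by (intro tripleI run_in_Assign) auto
    have pre_le: "size (pre x) \<le> poly q1 ?n"
      using computesD[OF c1, of "\<lambda>_. x" 0 ?n] by (auto simp: run_in_def)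
    have 2: "triple ?P1 (c1 N) (poly q1 ?n) ?P2"
      using N pre_le by (intro tripleI run_in_mono[OF computesD[OF c1, where n = ?n]]) auto
    have 3: "triple ?P2 (Assign (N + 1) (Var 0)) (2 + ?n) ?P3"
      using N by (intro tripleI run_in_Assign) auto
    have 4: "triple ?P3 (Assign 0 (Var N)) (2 + poly q1 ?n) ?P4"
      using N by (intro tripleI run_in_Assign) auto
    have tle: "t \<le> poly q (poly q1 ?n)"
      using t poly_nat_mono[OF pre_le, of q] by simp
    have y: "size y \<le> poly (Y q) ?n"
      using exec_size[OF s'(1), of 0] s'(2) tle pre_le by (simp add: Y_def poly_pcompose)
    have 5: "triple ?P4 p (poly q (poly q1 ?n)) ?P5"
    proof (rule tripleI)
      fix s assume s: "?P4 s"
      \<comment> \<open>Below \<open>N\<close> the state is the initial state of the known run, so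
        that run can be replayed with the current contents from \<open>N\<close> on as
        frame.\<close>
      have "merge_states N ((\<lambda>_. Leaf)(0 := pre x)) s = s"
        using s by (auto simp: merge_states_def fun_eq_iff)
      with exec_merge_states[OF s'(1) N(1), of s] have "exec p s t (merge_states N s' s)"
        by simp
      then show "run_in p s (poly q (poly q1 ?n)) ?P5"
        unfolding run_in_def using tle s s'(2) N(2) y
        by (intro exI[of _ t] exI[of _ "merge_states N s' s"]) (simp add: merge_states_def)
    qed
    have 6: "triple ?P5 (Assign N (ECons (Var 0) (Var (N + 1)))) (5 + 2 * ?n + 2 * poly (Y q) ?n) ?P6"
      by (intro tripleI run_in_Assign) auto
    have 7: "triple ?P6 (c2 N) (poly q2 (1 + ?n + poly (Y q) ?n)) ?P7"
      by (intro tripleI run_in_mono[OF computesD[OF c2, where n = "1 + ?n + poly (Y q) ?n"]]) auto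
    have 8: "triple ?P7 (Assign 0 (Var N)) (2 + poly q2 (1 + ?n + poly (Y q) ?n)) ?P8"
      by (intro tripleI run_in_Assign) auto
    have "run_in ?p' ?s0 (poly (Q q) ?n) ?P8"
      by (rule run_in_triple[OF triple_Seq[OF 1 triple_Seq[OF 2 triple_Seq[OF 3 triple_Seq[OF 4
              triple_Seq[OF 5 triple_Seq[OF 6 triple_Seq[OF 7 8]]]]]]]])
        (simp_all add: Q_def Y_def poly_pcompose)
    then show ?thesis
      unfolding run_in_def runs_def by blast
  qed
  then show ?thesis by (rule that)
qed

section \<open>The reduction\<close>

lemma makespan_le_iff:
  "finite (jobs I) \<Longrightarrow> makespan I \<sigma> \<le> k \<longleftrightarrow> (\<forall>v\<in>jobs I. snd (\<sigma> v) \<le> k)"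
  unfolding makespan_def by (subst Max_le_iff) auto

lemma min_makespan_le: "valid I \<sigma> \<Longrightarrow> min_makespan valid I \<le> makespan I \<sigma>"
  unfolding min_makespan_def by (rule Least_le) blast

lemma min_makespan_attained:
  assumes "valid I \<sigma>"
  obtains \<tau> where "valid I \<tau>" "makespan I \<tau> = min_makespan valid I"
proof -
  have "\<exists>\<tau>. valid I \<tau> \<and> makespan I \<tau> = min_makespan valid I"
    unfolding min_makespan_def by (rule LeastI_ex) (use assms in blast)
  then show ?thesis using that by blast
qed

definition own :: "('j, 'm) umps \<Rightarrow> 'j \<Rightarrow> 'm" where
  "own I v = (THE i. i \<in> machines I \<and> v \<in> part I i)"

lemma own_eqI:
  assumes "wf_umps I" "i \<in> machines I" "v \<in> part I i"
  shows "own I v = i"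
  unfolding own_def
proof (rule the_equality)
  fix j assume "j \<in> machines I \<and> v \<in> part I j"
  with assms show "j = i"
    unfolding wf_umps_def disjoint_family_on_def by blast
qed (use assms in simp)

lemma own_part:
  assumes "wf_umps I" "v \<in> jobs I"
  shows "own I v \<in> machines I" "v \<in> part I (own I v)"
proof -
  from assms obtain i where "i \<in> machines I" "v \<in> part I i"
    unfolding wf_umps_def by blast
  with own_eqI[OF assms(1) this] show "own I v \<in> machines I" "v \<in> part I (own I v)" by simp_all
qed

lemma valid_umps_own:
  assumes "wf_umps I" "valid_umps I \<sigma>" "v \<in> jobs I"
  shows "fst (\<sigma> v) = own I v"
  using assms(2) own_part[OF assms(1,3)] unfolding valid_umps_def by blast

text \<open>Time steps at which all machines are idle can be removed.\<close>

lemma min_makespan_umps_le_card: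
  assumes wf: "wf_umps I" and valid: "valid_umps I \<sigma>"
  shows "min_makespan valid_umps I \<le> card (jobs I)"
proof -
  have fin: "finite (jobs I)" using wf by (simp add: wf_umps_def wf_input_def)
  \<comment> \<open>\<open>S\<close> collects the busy steps, and \<open>rank\<close> renumbers them
    consecutively from 1. Being strictly increasing on \<open>S\<close>, it preserves precedences
    and injectivity.\<close>
  define S where "S = (\<lambda>v. snd (\<sigma> v)) ` jobs I"
  define rank where "rank t = card {s \<in> S. s \<le> t}" for t
  have S: "finite S" "card S \<le> card (jobs I)"
    using fin by (simp_all add: S_def card_image_le)
  have rank_less: "rank s < rank t" if "s < t" "t \<in> S" for s t
  proof -
    have "t \<in> {s' \<in> S. s' \<le> t} - {s' \<in> S. s' \<le> s}" using that by simp
    then have "{s' \<in> S. s' \<le> s} \<noteq> {s' \<in> S. s' \<le> t}" by blast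
    moreover have "{s' \<in> S. s' \<le> s} \<subseteq> {s' \<in> S. s' \<le> t}" using that(1) by auto
    ultimately show ?thesis
      unfolding rank_def using S(1) by (intro psubset_card_mono) auto
  qed
  have inS: "snd (\<sigma> v) \<in> S" if "v \<in> jobs I" for v
    using that by (simp add: S_def)
  have rank_inj: "s = t" if "rank s = rank t" "s \<in> S" "t \<in> S" for s t
    using rank_less[of s t] rank_less[of t s] that by (cases s t rule: linorder_cases) auto
  define \<tau> where "\<tau> v = (fst (\<sigma> v), rank (snd (\<sigma> v)))" for v
  have "valid_umps I \<tau>"
    unfolding valid_umps_def is_schedule_def
  proof (intro conjI ballI)
    fix v assume v: "v \<in> jobs I"
    then show "fst (\<tau> v) \<in> machines I"
      using valid by (simp add: \<tau>_def valid_umps_def is_schedule_def)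
    have "0 < rank (snd (\<sigma> v))"
      unfolding rank_def using S(1) inS[OF v] by (subst card_gt_0_iff) auto
    then show "1 \<le> snd (\<tau> v)" by (simp add: \<tau>_def)
  next
    have "inj_on \<sigma> (jobs I)" using valid by (simp add: valid_umps_def is_schedule_def)
    then show "inj_on \<tau> (jobs I)"
      using rank_inj inS by (auto simp: \<tau>_def inj_on_def prod_eq_iff)
  next
    fix i v assume "i \<in> machines I" "v \<in> part I i"
    then show "fst (\<tau> v) = i" using valid by (simp add: \<tau>_def valid_umps_def)
  next
    fix e assume e: "e \<in> prec I"
    obtain u v where "e = (u, v)" by fastforce
    moreover from e this have "u \<in> jobs I" "v \<in> jobs I" "snd (\<sigma> u) < snd (\<sigma> v)"
      using wf valid by (auto simp: wf_umps_def wf_input_def valid_umps_def)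
    ultimately show "case e of (u, v) \<Rightarrow> snd (\<tau> u) < snd (\<tau> v)"
      using rank_less inS by (simp add: \<tau>_def)
  qed
  moreover have "makespan I \<tau> \<le> card (jobs I)"
  proof -
    have "rank t \<le> card S" for t
      unfolding rank_def using S(1) by (intro card_mono) auto
    then show ?thesis
      unfolding makespan_le_iff[OF fin] \<tau>_def using S(2) by (auto intro: order_trans)
  qed
  ultimately show ?thesis using min_makespan_le[of valid_umps I \<tau>] by linarith
qed

text \<open>For \<open>K \<ge> \<alpha>\<close> and \<open>n\<close> jobs the delay is at least \<open>\<alpha> (n + 1)\<close>. Its binary notation is that of \<open>K\<close>
  with \<open>n\<close> ones prepended; likewise \<open>2 v + 1\<close> arises from \<open>v\<close> by prepending a one.\<close>

definition jmd_of_umps :: "nat \<Rightarrow> (nat, nat) umps \<Rightarrow> (nat, nat) jmd" where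
  "jmd_of_umps K I =
    \<lparr>jobs = insert 0 ((\<lambda>v. 2 * v + 1) ` jobs I),
     machines = machines I,
     prec = (\<lambda>v. (0, 2 * v + 1)) ` jobs I \<union> (\<lambda>(u, v). (2 * u + 1, 2 * v + 1)) ` prec I,
     delay = (\<lambda>w i. if w = 0 \<or> w div 2 \<in> part I i then 0
       else of_nat ((K + 1) * 2 ^ card (jobs I) - 1))\<rparr>"

lemma jmd_of_umps_simps [simp]:
  "jobs (jmd_of_umps K I) = insert 0 ((\<lambda>v. 2 * v + 1) ` jobs I)"
  "machines (jmd_of_umps K I) = machines I"
  "prec (jmd_of_umps K I) =
    (\<lambda>v. (0, 2 * v + 1)) ` jobs I \<union> (\<lambda>(u, v). (2 * u + 1, 2 * v + 1)) ` prec I"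
  "delay (jmd_of_umps K I) = (\<lambda>w i. if w = 0 \<or> w div 2 \<in> part I i then 0
       else of_nat ((K + 1) * 2 ^ card (jobs I) - 1))"
  by (simp_all add: jmd_of_umps_def)

text \<open>The numbers 2v+1 are distinct and avoid 0, and adding a least element keeps the order
  strict and transitive.\<close>

lemma wf_jmd_of_umps: "wf_umps I \<Longrightarrow> wf_jmd (jmd_of_umps K I)"
  unfolding wf_jmd_def wf_input_def wf_umps_def
  by (auto simp: irrefl_def trans_def)

text \<open>All jobs are shifted by one step and job 0 runs at step 1. The others sit on their own
  machines, where the delay is 0, so plain precedence suffices. A job of \<open>I\<close> is needed
  to supply a machine for job 0.\<close>

lemma valid_jmd_of_umps:
  assumes wf: "wf_umps I" and ne: "jobs I \<noteq> {}" and valid: "valid_umps I \<sigma>"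
  shows "\<exists>\<tau>. valid_jmd (jmd_of_umps K I) \<tau> \<and> makespan (jmd_of_umps K I) \<tau> \<le> makespan I \<sigma> + 1"
proof -
  have fin: "finite (jobs I)" using wf by (simp add: wf_umps_def wf_input_def)
  obtain v0 where v0: "v0 \<in> jobs I" using ne by blast
  have sched: "is_schedule I \<sigma>" using valid by (simp add: valid_umps_def)
  define \<tau> where "\<tau> w = (if w = 0 then (fst (\<sigma> v0), 1) else (fst (\<sigma> (w div 2)), snd (\<sigma> (w div 2)) + 1))"
    for w :: nat
  have "valid_jmd (jmd_of_umps K I) \<tau>"
    unfolding valid_jmd_def
  proof (intro conjI ballI)
    show "is_schedule (jmd_of_umps K I) \<tau>"
      using sched v0 unfolding is_schedule_def
      by (auto simp: \<tau>_def inj_on_def prod_eq_iff)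
  next
    have own: "v \<in> part I (fst (\<sigma> v))" if "v \<in> jobs I" for v
      using valid_umps_own[OF wf valid that] own_part[OF wf that] by simp
    have pos: "1 \<le> snd (\<sigma> v)" if "v \<in> jobs I" for v
      using sched that by (simp add: is_schedule_def)
    fix e assume e: "e \<in> prec (jmd_of_umps K I)"
    then consider v where "v \<in> jobs I" "e = (0, 2 * v + 1)"
      | u v where "(u, v) \<in> prec I" "e = (2 * u + 1, 2 * v + 1)"
      by auto
    then show "case e of (u, v) \<Rightarrow>
        fst (\<tau> u) = fst (\<tau> v) \<and> snd (\<tau> u) < snd (\<tau> v) \<or>
        of_nat (snd (\<tau> u)) < of_nat (snd (\<tau> v)) - delay (jmd_of_umps K I) v (fst (\<tau> v))"
    proof cases
      case 1
      then show ?thesis using own[of v] pos[of v] by (simp add: \<tau>_def)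
    next
      case 2
      then have "v \<in> jobs I" "snd (\<sigma> u) < snd (\<sigma> v)"
        using wf valid by (auto simp: wf_umps_def wf_input_def valid_umps_def)
      with 2 show ?thesis using own[of v] by (simp add: \<tau>_def)
    qed
  qed
  moreover have "makespan (jmd_of_umps K I) \<tau> \<le> makespan I \<sigma> + 1"
  proof -
    have "\<forall>v\<in>jobs I. snd (\<sigma> v) \<le> makespan I \<sigma>"
      using makespan_le_iff[OF fin, of \<sigma> "makespan I \<sigma>"] by simp
    then show ?thesis
      using fin by (subst makespan_le_iff) (auto simp: \<tau>_def)
  qed
  ultimately show ?thesis by blast
qed

text \<open>Step t becomes 2t for jobs on a foreign machine and 2t+1 for jobs on their own. For
  positive t the new time in binary is that of t with the flag prepended, which makes it easy to
  compute.\<close>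

definition umps_schedule :: "(nat, nat) umps \<Rightarrow> (nat, nat) schedule \<Rightarrow> (nat, nat) schedule" where
  "umps_schedule I \<sigma> v = (own I v, 2 * snd (\<sigma> (2 * v + 1)) + of_bool (fst (\<sigma> (2 * v + 1)) = own I v))"

text \<open>Both alternatives of \<open>valid_jmd\<close> force time to increase, and s < t gives
  2s+1 < 2t. Jobs that collided after the move would share the flag and the old time, and would
  already have shared a machine: their own one, or that of job 0 if both are foreign.\<close>

lemma valid_umps_schedule:
  assumes wf: "wf_umps I" and valid: "valid_jmd (jmd_of_umps K I) \<sigma>"
    and short: "makespan (jmd_of_umps K I) \<sigma> < (K + 1) * 2 ^ card (jobs I)"
  shows "valid_umps I (umps_schedule I \<sigma>)"
    and "makespan I (umps_schedule I \<sigma>) \<le> 2 * makespan (jmd_of_umps K I) \<sigma> + 1"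
proof -
  have fin: "finite (jobs I)" using wf by (simp add: wf_umps_def wf_input_def)
  then have fin': "finite (jobs (jmd_of_umps K I))" by simp
  have sched: "is_schedule (jmd_of_umps K I) \<sigma>" using valid by (simp add: valid_jmd_def)
  have le: "snd (\<sigma> (2 * v + 1)) \<le> makespan (jmd_of_umps K I) \<sigma>" if "v \<in> jobs I" for v
    using makespan_le_iff[OF fin', of \<sigma> "makespan (jmd_of_umps K I) \<sigma>"] that by simp
  have pos: "1 \<le> snd (\<sigma> (2 * v + 1))" and mach: "fst (\<sigma> (2 * v + 1)) \<in> machines I" if "v \<in> jobs I" for v
    using sched that by (auto simp: is_schedule_def)
  have inj: "u = v" if "\<sigma> (2 * u + 1) = \<sigma> (2 * v + 1)" "u \<in> jobs I" "v \<in> jobs I" for u v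
    using inj_onD[of \<sigma> "jobs (jmd_of_umps K I)" "2 * u + 1" "2 * v + 1"] sched that
    by (simp add: is_schedule_def)
  have prec: "fst (\<sigma> u) = fst (\<sigma> v) \<and> snd (\<sigma> u) < snd (\<sigma> v) \<or>
        of_nat (snd (\<sigma> u)) < of_nat (snd (\<sigma> v)) - delay (jmd_of_umps K I) v (fst (\<sigma> v))"
    if "(u, v) \<in> prec (jmd_of_umps K I)" for u v
    using valid that unfolding valid_jmd_def by blast
  \<comment> \<open>Off its own machine and off that of job 0, the job would wait more than the full
    delay after job 0. The delay is at least the makespan, so it would run too late.\<close>
  have root: "fst (\<sigma> (2 * v + 1)) = fst (\<sigma> 0)"
    if v: "v \<in> jobs I" and ne: "fst (\<sigma> (2 * v + 1)) \<noteq> own I v" for v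
  proof (rule ccontr)
    assume "fst (\<sigma> (2 * v + 1)) \<noteq> fst (\<sigma> 0)"
    moreover have "v \<notin> part I (fst (\<sigma> (2 * v + 1)))"
      using own_eqI[OF wf mach[OF v]] ne by metis
    ultimately have "rat_of_nat (snd (\<sigma> 0)) + of_nat ((K + 1) * 2 ^ card (jobs I) - 1) < of_nat (snd (\<sigma> (2 * v + 1)))"
      using prec[of 0 "2 * v + 1"] v by auto
    then have "snd (\<sigma> 0) + ((K + 1) * 2 ^ card (jobs I) - 1) < snd (\<sigma> (2 * v + 1))"
      by (metis of_nat_add of_nat_less_iff)
    with le[OF v] short show False by linarith
  qed
  have time: "snd (\<sigma> (2 * u + 1)) < snd (\<sigma> (2 * v + 1))" if "(u, v) \<in> prec I" for u v
  proof -
    have "0 \<le> delay (jmd_of_umps K I) (2 * v + 1) (fst (\<sigma> (2 * v + 1)))" by simp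
    then have "of_nat (snd (\<sigma> (2 * u + 1))) < rat_of_nat (snd (\<sigma> (2 * v + 1)))
        \<or> snd (\<sigma> (2 * u + 1)) < snd (\<sigma> (2 * v + 1))"
      using prec[of "2 * u + 1" "2 * v + 1"] that by force
    then show ?thesis by simp
  qed
  show "valid_umps I (umps_schedule I \<sigma>)"
    unfolding valid_umps_def is_schedule_def
  proof (intro conjI ballI)
    fix v assume v: "v \<in> jobs I"
    show "fst (umps_schedule I \<sigma> v) \<in> machines I" "1 \<le> snd (umps_schedule I \<sigma> v)"
      using own_part[OF wf v] pos[OF v] by (simp_all add: umps_schedule_def)
  next
    show "inj_on (umps_schedule I \<sigma>) (jobs I)"
    proof (rule inj_onI)
      fix u v assume uv: "u \<in> jobs I" "v \<in> jobs I" "umps_schedule I \<sigma> u = umps_schedule I \<sigma> v"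
      let ?b = "\<lambda>v. fst (\<sigma> (2 * v + 1)) = own I v"
      have own: "own I u = own I v"
        and eq: "2 * snd (\<sigma> (2 * u + 1)) + of_bool (?b u) = 2 * snd (\<sigma> (2 * v + 1)) + of_bool (?b v)"
        using uv(3) unfolding umps_schedule_def prod.inject by blast+
      \<comment> \<open>Halving recovers the old time and parity recovers the flag.\<close>
      have t: "snd (\<sigma> (2 * u + 1)) = snd (\<sigma> (2 * v + 1))" and b: "?b u = ?b v"
        using arg_cong[OF eq, of "\<lambda>n. n div 2"] arg_cong[OF eq, of even] by auto
      have "fst (\<sigma> (2 * u + 1)) = fst (\<sigma> (2 * v + 1))"
        using own b root[OF uv(1)] root[OF uv(2)] by metis
      then have "\<sigma> (2 * u + 1) = \<sigma> (2 * v + 1)" using t by (rule prod_eqI)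
      then show "u = v" using uv(1,2) by (rule inj)
    qed
  next
    fix i v assume "i \<in> machines I" "v \<in> part I i"
    then show "fst (umps_schedule I \<sigma> v) = i"
      using own_eqI[OF wf] by (simp add: umps_schedule_def)
  next
    fix e assume "e \<in> prec I"
    moreover obtain u v where "e = (u, v)" by fastforce
    ultimately show "case e of (u, v) \<Rightarrow> snd (umps_schedule I \<sigma> u) < snd (umps_schedule I \<sigma> v)"
      using time[of u v] by (auto simp: umps_schedule_def)
  qed
  show "makespan I (umps_schedule I \<sigma>) \<le> 2 * makespan (jmd_of_umps K I) \<sigma> + 1"
    unfolding makespan_le_iff[OF fin] using le by (fastforce simp: umps_schedule_def)
qed

lemma umps_schedule_approx:
  fixes \<alpha> :: real
  assumes wf: "wf_umps I" and ne: "jobs I \<noteq> {}" and ex: "valid_umps I \<tau>"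
    and \<alpha>: "1 \<le> \<alpha>" "\<alpha> \<le> real K"
    and valid: "valid_jmd (jmd_of_umps K I) \<sigma>"
    and approx: "real (makespan (jmd_of_umps K I) \<sigma>)
      \<le> \<alpha> * real (min_makespan valid_jmd (jmd_of_umps K I))"
  shows "valid_umps I (umps_schedule I \<sigma>)"
    and "real (makespan I (umps_schedule I \<sigma>)) \<le> 6 * \<alpha> * real (min_makespan valid_umps I)"
proof -
  let ?n = "card (jobs I)" and ?opt = "min_makespan valid_umps I"
  let ?X = "makespan (jmd_of_umps K I) \<sigma>"
  have fin: "finite (jobs I)" using wf by (simp add: wf_umps_def wf_input_def)
  obtain \<tau>' where \<tau>': "valid_umps I \<tau>'" "makespan I \<tau>' = ?opt"
    using min_makespan_attained[of valid_umps I] ex by blast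
  \<comment> \<open>The reduction cannot know the optimum, but it can count the jobs; this bound
    turns the computable delay into one beyond \<alpha> (opt + 1).\<close>
  have opt_n: "?opt \<le> ?n"
    using min_makespan_umps_le_card[OF wf ex] .
  have opt1: "1 \<le> ?opt"
  proof -
    obtain v where v: "v \<in> jobs I" using ne by blast
    then have "1 \<le> snd (\<tau>' v)" using \<tau>'(1) by (simp add: valid_umps_def is_schedule_def)
    also have "\<dots> \<le> ?opt" using makespan_le_iff[OF fin, of \<tau>' ?opt] \<tau>'(2) v by simp
    finally show ?thesis .
  qed
  obtain \<rho> where \<rho>: "valid_jmd (jmd_of_umps K I) \<rho>" "makespan (jmd_of_umps K I) \<rho> \<le> ?opt + 1"
    using valid_jmd_of_umps[OF wf ne \<tau>'(1), of K] \<tau>'(2) by auto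
  have "min_makespan valid_jmd (jmd_of_umps K I) \<le> ?opt + 1"
    using min_makespan_le[of valid_jmd, OF \<rho>(1)] \<rho>(2) by linarith
  then have X: "real ?X \<le> \<alpha> * (real ?opt + 1)"
    using approx \<alpha>(1) by (smt (verit) mult_left_mono of_nat_mono of_nat_Suc Suc_eq_plus1)
  also have "\<dots> \<le> real K * (real ?n + 1)"
    using \<alpha> opt_n by (intro mult_mono) auto
  also have "\<dots> = real (K * (?n + 1))" by (simp add: algebra_simps)
  finally have "?X \<le> K * (?n + 1)" by (simp only: of_nat_le_iff)
  also have "\<dots> < (K + 1) * (?n + 1)" by simp
  also have "\<dots> \<le> (K + 1) * 2 ^ ?n"
    using less_exp[of ?n] by (intro mult_left_mono) (simp_all only: Suc_eq_plus1[symmetric] Suc_le_eq zero_le)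
  finally have short: "?X < (K + 1) * 2 ^ ?n" .
  show "valid_umps I (umps_schedule I \<sigma>)"
    using valid_umps_schedule(1)[OF wf valid short] .
  have "real (makespan I (umps_schedule I \<sigma>)) \<le> real (2 * ?X + 1)"
    using valid_umps_schedule(2)[OF wf valid short] by (simp only: of_nat_le_iff)
  also have "\<dots> \<le> 2 * (\<alpha> * (real ?opt + 1)) + 1" using X by simp
  also have "\<dots> \<le> 6 * \<alpha> * real ?opt"
  proof -
    \<comment> \<open>Since \<alpha> opt is at least \<alpha> and hence at least 1, it absorbs both
      additive terms: the sum is at most 5 \<alpha> opt.\<close>
    have "\<alpha> * 1 \<le> \<alpha> * real ?opt" using \<alpha>(1) opt1 by (intro mult_left_mono) auto
    moreover have "2 * (\<alpha> * (real ?opt + 1)) + 1 = 2 * (\<alpha> * real ?opt) + 2 * \<alpha> + 1"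
      by (simp add: distrib_left)
    ultimately show ?thesis using \<alpha>(1) by linarith
  qed
  finally show "real (makespan I (umps_schedule I \<sigma>)) \<le> 6 * \<alpha> * real ?opt" .
qed

section \<open>The reduction on encodings\<close>

abbreviation tt :: tree where
  "tt \<equiv> Node Leaf Leaf"

lemma enc_nat_0 [simp]: "enc_nat 0 = Leaf"
  by (simp add: enc_nat.simps[of 0])

lemma enc_nat_pos: "0 < n \<Longrightarrow> enc_nat n = Node (enc_bool (odd n)) (enc_nat (n div 2))"
  by (simp add: enc_nat.simps[of n])

lemma enc_nat_odd [simp]: "enc_nat (Suc (2 * n)) = Node tt (enc_nat n)"
  by (simp add: enc_nat_pos enc_bool_def)

text \<open>Positivity matters: zero is written \<open>Leaf\<close>, so a zero bit prepended to it
  would not be a canonical notation.\<close>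

lemma enc_nat_double: "0 < n \<Longrightarrow> enc_nat (2 * n) = Node Leaf (enc_nat n)"
  by (simp add: enc_nat_pos[of "2 * n"] enc_bool_def)

lemma enc_bool_eq_Leaf [simp]: "enc_bool b = Leaf \<longleftrightarrow> \<not> b"
  by (simp add: enc_bool_def)

lemma enc_list_Nil [simp]: "enc_list f [] = Leaf"
  by (simp add: enc_list_def)

lemma enc_list_Cons [simp]: "enc_list f (x # xs) = Node (f x) (enc_list f xs)"
  by (simp add: enc_list_def)

lemma enc_list_map: "enc_list f (map g xs) = enc_list (\<lambda>x. f (g x)) xs"
  by (induction xs) simp_all

lemma enc_list_cong: "(\<And>x. x \<in> set xs \<Longrightarrow> f x = g x) \<Longrightarrow> enc_list f xs = enc_list g xs"
  by (induction xs) simp_all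

lemma foldt_enc_list: "foldt g (enc_list f xs) a = fold (\<lambda>x. g (f x)) xs a"
  by (induction xs arbitrary: a) simp_all

lemma fold_Node: "fold (\<lambda>x. Node (f x)) xs Leaf = enc_list f (rev xs)"
  by (simp add: enc_list_def foldr_conv_fold)

lemma revt_enc_list: "revt (enc_list f xs) = enc_list f (rev xs)"
  by (simp add: revt_def foldt_enc_list fold_Node)

lemma mapt_enc_list [simp]: "mapt g (enc_list f xs) = enc_list (\<lambda>x. g (f x)) xs"
  by (simp add: mapt_def foldt_enc_list fold_Node revt_enc_list)

lemma zipt_enc_list [simp]: "zipt (enc_list f xs) (enc_list g xs) = enc_list (\<lambda>x. Node (f x) (g x)) xs"
proof -
  have "right (foldt (\<lambda>e a. Node (right (left a)) (Node (Node e (left (left a))) (right a)))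
      (enc_list f xs) (Node (enc_list g xs) a)) = fold (\<lambda>x. Node (Node (f x) (g x))) xs a" for a
    by (induction xs arbitrary: a) simp_all
  then show ?thesis
    by (simp add: zipt_def fold_Node revt_enc_list)
qed

text \<open>Serves in two readings: started from the notation of \<open>K\<close> it writes the
  large delay, and started from \<open>Leaf\<close> it writes the row of truth values saying that
  job 0 precedes all others.\<close>

definition onest :: "tree \<Rightarrow> tree \<Rightarrow> tree" where
  "onest l c = foldt (\<lambda>_. Node tt) l c"

lemma ptime_onest [ptime]: "ptime f \<Longrightarrow> ptime g \<Longrightarrow> ptime (\<lambda>x. onest (f x) (g x))"
  unfolding onest_def
  by (rule ptime_foldt[where g = "\<lambda>e a x. Node tt a" and r = 2]) (assumption | intro ptime | simp)+

text \<open>Prepending a one maps K to 2K+1, that is, it doubles K+1.\<close>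

lemma onest_enc_list: "onest (enc_list f xs) (enc_nat K) = enc_nat ((K + 1) * 2 ^ length xs - 1)"
proof (induction xs arbitrary: K)
  case (Cons x xs)
  have "onest (enc_list f (x # xs)) (enc_nat K) = onest (enc_list f xs) (enc_nat (Suc (2 * K)))"
    by (simp add: onest_def)
  also have "\<dots> = enc_nat ((K + 1) * 2 ^ length (x # xs) - 1)"
    unfolding Cons.IH by (simp add: algebra_simps)
  finally show ?case .
qed (simp add: onest_def)

definition selectt :: "tree \<Rightarrow> tree \<Rightarrow> tree" where
  "selectt l m = foldt (\<lambda>e a. if right e \<noteq> Leaf then left e else a) (zipt l m) Leaf"

lemma ptime_selectt [ptime]:
  assumes "ptime f" "ptime g"
  shows "ptime (\<lambda>x. selectt (f x) (g x))"
  unfolding selectt_def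
proof (rule ptime_foldt[where g = "\<lambda>e a x. if right e \<noteq> Leaf then left e else a" and r = "[:0, 1:]"])
  fix e a x :: tree
  show "size (if right e \<noteq> Leaf then left e else a) \<le> size a + poly [:0, 1:] (size e + size x)"
    using size_left_right[of e] by simp
qed (intro ptime assms)+

lemma selectt_enc_list:
  assumes "\<exists>!i. i \<in> set xs \<and> P i"
  shows "selectt (enc_list f xs) (enc_list (\<lambda>i. enc_bool (P i)) xs) = f (THE i. i \<in> set xs \<and> P i)"
proof -
  \<comment> \<open>Arbitrary start values and lists without \<open>j\<close> are allowed, because
    the induction goes on past the only flagged entry.\<close>
  have *: "fold (\<lambda>i a. if P i then f i else a) ys c = (if j \<in> set ys then f j else c)"
    if "\<And>i. i \<in> set ys \<Longrightarrow> P i \<longleftrightarrow> i = j" for ys j c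
    using that by (induction ys arbitrary: c) auto
  obtain j where j: "j \<in> set xs" "P j" "\<And>i. i \<in> set xs \<Longrightarrow> P i \<longleftrightarrow> i = j"
    using assms by blast
  have "(THE i. i \<in> set xs \<and> P i) = j"
    using j by (intro the_equality) auto
  then show ?thesis
    using *[OF j(3)] j(1) by (simp add: selectt_def foldt_enc_list)
qed

text \<open>The accumulator pairs the verdict so far with the unread bits of the second number. A
  differing bit, or running out of bits, resets the verdict to \<open>Leaf\<close>; unread bits left
  at the end are checked in \<open>eqt\<close>.\<close>

definition eqt_step :: "tree \<Rightarrow> tree \<Rightarrow> tree" where
  "eqt_step e a = Node (if right a \<noteq> Leaf
     then if e \<noteq> Leaf then if left (right a) \<noteq> Leaf then left a else Leaf
       else if left (right a) \<noteq> Leaf then Leaf else left a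
     else Leaf) (right (right a))"

definition eqt :: "tree \<Rightarrow> tree \<Rightarrow> tree" where
  "eqt l m = (let a = foldt eqt_step l (Node tt m) in
     if left a \<noteq> Leaf then if right a \<noteq> Leaf then Leaf else tt else Leaf)"

lemma ptime_eqt [ptime]:
  assumes "ptime f" "ptime g"
  shows "ptime (\<lambda>x. eqt (f x) (g x))"
proof -
  have "ptime (\<lambda>x. foldt eqt_step (f x) (Node tt (g x)))"
  proof (rule ptime_foldt[where g = "\<lambda>e a x. eqt_step e a" and r = 1])
    fix e a x :: tree
    show "size (eqt_step e a) \<le> size a + poly 1 (size e + size x)"
      using size_left_right[of a] size_left_right[of "right a"] by (simp add: eqt_step_def)
    show "ptime (\<lambda>z. eqt_step (left z) (left (right z)))"
      unfolding eqt_step_def by (intro ptime)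
  qed (intro ptime assms)+
  then show ?thesis
    unfolding eqt_def Let_def by (intro ptime)
qed

lemma eqt_enc_nat: "eqt (enc_nat i) (enc_nat j) = enc_bool (i = j)"
proof -
  \<comment> \<open>The verdict \<open>a\<close> is arbitrary, since the induction on halves
    continues after a mismatch has cleared it.\<close>
  have "left (foldt eqt_step (enc_nat i) (Node a (enc_nat j))) \<noteq> Leaf \<and>
      right (foldt eqt_step (enc_nat i) (Node a (enc_nat j))) = Leaf \<longleftrightarrow> a \<noteq> Leaf \<and> i = j" for a
  proof (induction i arbitrary: a j rule: less_induct)
    case (less i)
    show ?case
    proof (cases "i = 0")
      case True
      then show ?thesis by (cases "j = 0") (auto simp: enc_nat_pos)
    next
      case i: False
      show ?thesis
      proof (cases "j = 0")
        case True
        have "eqt_step (enc_bool (odd i)) (Node a (enc_nat j)) = Node Leaf (enc_nat 0)"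
          using True by (simp add: eqt_step_def)
        then show ?thesis
          using less[of "i div 2" Leaf 0] i True by (simp add: enc_nat_pos)
      next
        case False
        have "eqt_step (enc_bool (odd i)) (Node a (enc_nat j))
            = Node (if odd i = odd j then a else Leaf) (enc_nat (j div 2))"
          using False by (simp add: eqt_step_def enc_nat_pos)
        moreover have "i = j \<longleftrightarrow> odd i = odd j \<and> i div 2 = j div 2"
          by (metis bit_eq_rec)
        ultimately show ?thesis
          using less[of "i div 2" "if odd i = odd j then a else Leaf" "j div 2"] i
          by (auto simp: enc_nat_pos)
      qed
    qed
  qed
  from this[of tt] show ?thesis
    by (auto simp: eqt_def Let_def enc_bool_def)
qed

text \<open>In \<open>x\<close>, \<open>left (left x)\<close> lists the jobs,
  \<open>left (right (left x))\<close> the machines, \<open>right (right (left x))\<close> is the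
  precedence matrix and \<open>right x\<close> the membership matrix. The relation gets a row for
  job 0 and a false entry at the front of every row, as nothing precedes job 0. Delays are fractions
  with denominator 1, whose notation is \<open>Node tt Leaf\<close>.\<close>

definition jmd_tree :: "tree \<Rightarrow> tree \<Rightarrow> tree" where
  "jmd_tree k x =
    Node
      (Node (Node Leaf (mapt (Node tt) (left (left x))))
        (Node (left (right (left x)))
          (Node (Node Leaf (onest (left (left x)) Leaf)) (mapt (Node Leaf) (right (right (left x)))))))
      (Node (mapt (\<lambda>_. Node Leaf (Node tt Leaf)) (left (right (left x))))
        (mapt (mapt (\<lambda>b. Node (if b \<noteq> Leaf then Leaf else onest (left (left x)) k) (Node tt Leaf)))
          (right x)))"

lemma ptime_jmd_tree: "ptime (jmd_tree k)"
  unfolding jmd_tree_def by (intro ptime)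

text \<open>The renumbering is increasing, so encoded families keep their order and are translated
  entry by entry.\<close>

lemma sorted_list_of_set_jobs:
  fixes A :: "nat set"
  assumes "finite A"
  shows "sorted_list_of_set (insert 0 ((\<lambda>v. 2 * v + 1) ` A)) = 0 # map (\<lambda>v. 2 * v + 1) (sorted_list_of_set A)"
    (is "_ = ?xs")
proof -
  have "sorted ?xs"
    by (auto simp: sorted_map intro: sorted_wrt_mono_rel[OF _ sorted_sorted_list_of_set])
  moreover have "distinct ?xs"
    by (auto simp: distinct_map inj_on_def)
  ultimately have "sorted_list_of_set (set ?xs) = ?xs"
    by (rule sorted_list_of_set.idem_if_sorted_distinct)
  then show ?thesis using assms by simp
qed

lemma enc_rat_of_nat: "enc_rat (of_nat n) = Node (enc_nat n) (Node tt Leaf)"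
proof -
  have "quotient_of (of_nat n) = (int n, 1)"
    using quotient_of_int[of "int n"] by simp
  moreover have "enc_nat 1 = Node tt Leaf"
    using enc_nat_odd[of 0] by simp
  ultimately show ?thesis by (simp add: enc_rat_def)
qed

lemma jmd_tree_enc_umps:
  assumes "wf_umps I"
  shows "jmd_tree (enc_nat K) (enc_umps I) = enc_jmd (jmd_of_umps K I)"
proof -
  have fin: "finite (jobs I)" using assms by (simp add: wf_umps_def wf_input_def)
  have prec: "(0, Suc (2 * v)) \<in> prec (jmd_of_umps K I) \<longleftrightarrow> v \<in> jobs I"
    "(Suc (2 * u), Suc (2 * v)) \<in> prec (jmd_of_umps K I) \<longleftrightarrow> (u, v) \<in> prec I"
    "(w, 0) \<notin> prec (jmd_of_umps K I)" for u v w
    by (auto simp del: mult_Suc_right)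
  have L: "onest (enc_list f (sorted_list_of_set (jobs I))) (enc_nat K)
      = enc_nat ((K + 1) * 2 ^ card (jobs I) - 1)" for f :: "nat \<Rightarrow> tree"
    by (simp add: onest_enc_list)
  have ones: "onest (enc_list f xs) Leaf = enc_list (\<lambda>_. tt) xs" for f :: "nat \<Rightarrow> tree" and xs
  proof -
    have "fold (\<lambda>_. Node tt) xs Leaf = enc_list (\<lambda>_. tt) (rev xs)"
      using fold_Node[of "\<lambda>_. tt"] .
    \<comment> \<open>The fold reverses the list, which is harmless for constant entries.\<close>
    also have "\<dots> = enc_list (\<lambda>_. tt) xs"
      by (simp add: enc_list_map[of "\<lambda>x. x" "\<lambda>_. tt", symmetric] map_replicate_const)
    finally show ?thesis by (simp add: onest_def foldt_enc_list)
  qed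
  show ?thesis
    unfolding jmd_tree_def enc_umps_def enc_jmd_def enc_input_def enc_set_def enc_fam_def
      jmd_of_umps_simps(1,2) sorted_list_of_set_jobs[OF fin]
    using fin enc_rat_of_nat[of 0]
    by (auto simp: enc_list_map prec L ones enc_rat_of_nat enc_bool_def simp del: jmd_of_umps_simps(3)
        intro!: enc_list_cong)
qed

text \<open>\<open>right y\<close> drops the entry of job 0. Each \<open>e\<close> pairs the
  membership row of a job with its machine and time; the row selects the own machine, and the
  outcome of the comparison with the scheduled machine is prepended to the time as its lowest
  bit.\<close>

definition umps_schedule_tree :: "tree \<Rightarrow> tree \<Rightarrow> tree" where
  "umps_schedule_tree y x =
    mapt (\<lambda>e. Node (selectt (left (right (left x))) (left e))
        (Node (eqt (left (right e)) (selectt (left (right (left x))) (left e))) (right (right e))))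
      (zipt (right x) (right y))"

lemma ptime_umps_schedule_tree: "ptime (\<lambda>z. umps_schedule_tree (left z) (right z))"
  unfolding umps_schedule_tree_def by (intro ptime)

lemma umps_schedule_tree_enc:
  assumes wf: "wf_umps I" and valid: "valid_jmd (jmd_of_umps K I) \<sigma>"
  shows "umps_schedule_tree (enc_schedule (jmd_of_umps K I) \<sigma>) (enc_umps I)
    = enc_schedule I (umps_schedule I \<sigma>)"
proof -
  have fin: "finite (jobs I)" "finite (machines I)" using wf by (simp_all add: wf_umps_def wf_input_def)
  have own: "selectt (enc_list enc_nat (sorted_list_of_set (machines I)))
      (enc_list (\<lambda>i. enc_bool (v \<in> part I i)) (sorted_list_of_set (machines I))) = enc_nat (own I v)"
    if "v \<in> jobs I" for v
  proof -
    have "\<exists>!i. i \<in> set (sorted_list_of_set (machines I)) \<and> v \<in> part I i"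
      using own_part[OF wf that] own_eqI[OF wf] fin by auto
    from selectt_enc_list[OF this, of enc_nat] show ?thesis
      using fin by (simp add: own_def)
  qed
  have time: "Node (enc_bool b) (enc_nat (snd (\<sigma> (Suc (2 * v))))) = enc_nat (2 * snd (\<sigma> (Suc (2 * v))) + of_bool b)"
    if "v \<in> jobs I" for v b
  proof -
    \<comment> \<open>Steps start at 1, so a prepended zero bit still gives a canonical
      notation.\<close>
    have "0 < snd (\<sigma> (Suc (2 * v)))"
      using valid that by (auto simp: valid_jmd_def is_schedule_def)
    then show ?thesis by (cases b) (simp_all add: enc_nat_double enc_bool_def)
  qed
  show ?thesis
    unfolding umps_schedule_tree_def enc_umps_def enc_schedule_def enc_input_def enc_set_def enc_fam_def
      jmd_of_umps_simps(1,2) sorted_list_of_set_jobs[OF fin(1)]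
    using fin
    by (auto simp: enc_list_map own time eqt_enc_nat umps_schedule_def case_prod_beta
        intro!: enc_list_cong)
qed

theorem theorem4:
  fixes \<alpha> :: real
  assumes "\<alpha> \<ge> 1"
    and "\<exists>p. poly_time_approx_jmd \<alpha> p"
  shows "\<exists>p. poly_time_approx_umps (6 * \<alpha>) p"
proof -
  from assms(2) obtain p q where pq: "\<And>I. wf_jmd I \<Longrightarrow>
      \<exists>t y. runs p (enc_jmd I) t y \<and> t \<le> poly q (size (enc_jmd I)) \<and>
        ((\<exists>\<sigma>. valid_jmd I \<sigma>) \<longrightarrow> (\<exists>\<sigma>. y = enc_schedule I \<sigma> \<and> valid_jmd I \<sigma> \<and>
          real (makespan I \<sigma>) \<le> \<alpha> * real (min_makespan valid_jmd I)))"
    unfolding poly_time_approx_jmd_def poly_time_approx_def by blast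
  \<comment> \<open>\<open>K\<close> depends on \<alpha> alone, so its notation can be built into
    the program as a constant, and \<alpha> itself need not be computable.\<close>
  obtain K where K: "\<alpha> \<le> real K" using real_arch_simple by blast
  obtain p' and Q :: "nat poly \<Rightarrow> nat poly" where p':
    "\<And>q x t y. runs p (jmd_tree (enc_nat K) x) t y \<Longrightarrow> t \<le> poly q (size (jmd_tree (enc_nat K) x)) \<Longrightarrow>
       \<exists>t'. runs p' x t' (umps_schedule_tree y x) \<and> t' \<le> poly (Q q) (size x)"
    using ptime_around_program[OF ptime_jmd_tree ptime_umps_schedule_tree, of p "enc_nat K"] by auto
  have "\<exists>t y. runs p' (enc_umps I) t y \<and> t \<le> poly (Q q) (size (enc_umps I)) \<and>
      ((\<exists>\<sigma>. valid_umps I \<sigma>) \<longrightarrow> (\<exists>\<sigma>. y = enc_schedule I \<sigma> \<and> valid_umps I \<sigma> \<and>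
        real (makespan I \<sigma>) \<le> 6 * \<alpha> * real (min_makespan valid_umps I)))"
    if wf: "wf_umps I" for I
  proof -
    let ?J = "jmd_of_umps K I"
    from pq[OF wf_jmd_of_umps[OF wf, of K]] obtain t y where
      ty: "runs p (enc_jmd ?J) t y" "t \<le> poly q (size (enc_jmd ?J))" and
      y: "(\<exists>\<sigma>. valid_jmd ?J \<sigma>) \<longrightarrow> (\<exists>\<sigma>. y = enc_schedule ?J \<sigma> \<and> valid_jmd ?J \<sigma> \<and>
          real (makespan ?J \<sigma>) \<le> \<alpha> * real (min_makespan valid_jmd ?J))"
      by blast
    from p'[of "enc_umps I" t y q] ty obtain t' where
      t': "runs p' (enc_umps I) t' (umps_schedule_tree y (enc_umps I))" "t' \<le> poly (Q q) (size (enc_umps I))"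
      by (auto simp: jmd_tree_enc_umps[OF wf])
    have "\<exists>\<sigma>. umps_schedule_tree y (enc_umps I) = enc_schedule I \<sigma> \<and> valid_umps I \<sigma> \<and>
        real (makespan I \<sigma>) \<le> 6 * \<alpha> * real (min_makespan valid_umps I)"
      if \<tau>: "valid_umps I \<tau>" for \<tau>
    proof (cases "jobs I = {}")
      \<comment> \<open>Without jobs there may be no machine either; then job 0 cannot be scheduled
        and \<open>y\<close> is unconstrained. The translated output is the empty list whatever
        \<open>y\<close> is.\<close>
      case True
      then have "umps_schedule_tree y (enc_umps I) = enc_schedule I \<tau>"
        by (simp add: umps_schedule_tree_def enc_umps_def enc_fam_def enc_schedule_def zipt_def mapt_def revt_def)
      moreover have "makespan I \<tau> = 0" using True by (simp add: makespan_def)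
      ultimately show ?thesis using \<tau> assms(1) by auto
    next
      case False
      obtain \<rho> where "valid_jmd ?J \<rho>" using valid_jmd_of_umps[OF wf False \<tau>] by blast
      with y obtain \<sigma> where \<sigma>: "y = enc_schedule ?J \<sigma>" "valid_jmd ?J \<sigma>"
          "real (makespan ?J \<sigma>) \<le> \<alpha> * real (min_makespan valid_jmd ?J)"
        by blast
      show ?thesis
        using umps_schedule_approx[OF wf False \<tau> assms(1) K \<sigma>(2,3)] umps_schedule_tree_enc[OF wf \<sigma>(2)] \<sigma>(1)
        by blast
    qed
    with t' show ?thesis by blast
  qed
  then show ?thesis
    unfolding poly_time_approx_umps_def poly_time_approx_def by blast
qed

end
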